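(* Let $\bar\sigma\in\Sigma$ be the true parameter. There exists a constant $c_\infty>0$ independent of $N$ for which the bounds $$\|\widehat{x}_\infty(t)-\widehat{x}_{\bar\sigma}(t)\|_{P_{\bar\sigma}(t)}\le c_\infty\max_{j}\|\mathcal{S}_j-\mathcal{S}_{\bar\sigma}\|_1,\qquad \|\widehat{x}_\theta(t)-\widehat{x}_{\bar\sigma}(t)\|_{P_{\bar\sigma}(t)}\le c_\infty\max_{j}\|\mathcal{S}_j-\mathcal{S}_{\bar\sigma}\|_1$$ hold for all $t\in[0,T]$, $\theta\in(0,\infty)$, and, with this same constant, for all $\theta\in(0,\infty)$ and $t\in[0,T]$ $$\|\widehat{x}_\theta(t)-\widehat{x}_{\bar\sigma}(t)\|_{P_{\bar\sigma}(t)}\le c_\infty\,e^{\theta J(t,\theta)}\,\mathbb{E}\left[\|\mathcal{S}_\sigma-\mathcal{S}_{\bar\sigma}\|_1\right],$$ where $J(t,\theta)=\max_{k,j\in\{1,\dots,N\}}\left[\mathcal{V}_k(t,\widehat{x}_\theta(t))-\mathcal{V}_j(t,\widehat{x}_\theta(t))\right]$.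
   Context: Setting. Fix $T>0$, $n,m,r\in\mathbb{N}$, $B\in\mathbb{R}^{n\times m}$, $C\in\mathbb{R}^{r\times n}$, $x_0\in\mathbb{R}^n$ and a measured output $y\in L^2(0,T;\mathbb{R}^r)$. $\|\cdot\|$ is the Euclidean norm, and $\|x\|_M^2=x^\top M x$ for a symmetric positive definite matrix $M$. Let $\Sigma=\Sigma_A\times\Sigma_\Gamma\times\Sigma_R\times\Sigma_Q$ be a product of finite nonempty sets, $\Sigma=\{\sigma_1,\dots,\sigma_N\}$, $N=|\Sigma|$, with the uniform probability, so that $\mathbb{E}[X_\sigma]=\frac1N\sum_{k=1}^NX_{\sigma_k}$. To each $\sigma=(\sigma_A,\sigma_\Gamma,\sigma_R,\sigma_Q)$ are assigned matrices $A_\sigma\in\mathbb{R}^{n\times n}$ (depending on $\sigma_A$ only) and symmetric positive definite matrices $\Gamma_\sigma\in\mathbb{R}^{n\times n}$, $R_\sigma\in\mathbb{R}^{m\times m}$, $Q_\sigma\in\mathbb{R}^{r\times r}$ (depending only on $\sigma_\Gamma$, $\sigma_R$, $\sigma_Q$ respectively). Index $k$ means $\sigma=\sigma_k$. Write $\mathcal{S}_\sigma=(A_\sigma,\Gamma_\sigma,R_\sigma,Q_\sigma)$ and, for such tuples (and their componentwise differences), $\|(A,\Gamma,R,Q)\|_1=\|A\|+\|\Gamma\|+\|R\|+\|Q\|$ with a fixed matrix norm. For each $\sigma\in\Sigma$, $\Pi_\sigma$ is the unique solution on $[0,T]$ of $\dot\Pi_\sigma = A_\sigma\Pi_\sigma+\Pi_\sigma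 A_\sigma^\top-\Pi_\sigma C^\top Q_\sigma^{-1}C\Pi_\sigma+BR_\sigma B^\top$, $\Pi_\sigma(0)=\Gamma_\sigma$ (symmetric positive definite for all $t$), $P_\sigma(t)=\Pi_\sigma(t)^{-1}$, and $\widehat{x}_\sigma\in H^1(0,T;\mathbb{R}^n)$ solves $\dot{\widehat{x}}_\sigma=A_\sigma\widehat{x}_\sigma+\Pi_\sigma C^\top Q_\sigma^{-1}(y-C\widehat{x}_\sigma)$, $\widehat{x}_\sigma(0)=x_0$. Set $r_k(t)=\int_0^t\|y(s)-C\widehat{x}_k(s)\|_{Q_k^{-1}}^2\,ds$ and $\mathcal{V}_k(t,x)=\|x-\widehat{x}_k(t)\|_{P_k(t)}^2+r_k(t)$. Estimators (each minimizer over $x\in\mathbb{R}^n$ exists and is unique): $\widehat{x}_\infty(t)$ minimizes $\max_{k=1,\dots,N}\mathcal{V}_k(t,x)$; for $\theta\in(0,\infty)$, $\widehat{x}_\theta(t)$ minimizes $\frac1\theta\ln\left(\frac1N\sum_{k=1}^Ne^{\theta\mathcal{V}_k(t,x)}\right)$. Meaning of "independent of $N$": given a compact set $\mathcal{K}$ of tuples $(A,\Gamma,R,Q)$ with $\Gamma,R,Q$ symmetric positive definite that contains all $\mathcal{S}_k$, the constant may depend on $\mathcal{K},T,B,C,x_0,y$ but not on the number $N$ of parameters. *)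

theory Defs
  imports "HOL-Analysis.Analysis"
begin

definition sym_posdef :: "real^'n^'n \<Rightarrow> bool" where
  "sym_posdef M \<longleftrightarrow> transpose M = M \<and> (\<forall>x. x \<noteq> 0 \<longrightarrow> 0 < x \<bullet> (M *v x))"

definition wnorm_sq :: "real^'n^'n \<Rightarrow> real^'n \<Rightarrow> real" where
  "wnorm_sq M x = x \<bullet> (M *v x)"

definition wnorm :: "real^'n^'n \<Rightarrow> real^'n \<Rightarrow> real" where
  "wnorm M x = sqrt (wnorm_sq M x)"

text \<open>The type class \<open>real_normed_vector\<close> carries just one norm per type (on matrices the
  Frobenius norm); this predicate allows the matrix norm to be arbitrary.\<close>

definition is_norm :: "('a::real_vector \<Rightarrow> real) \<Rightarrow> bool" where
  "is_norm \<nu> \<longleftrightarrow>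
     (\<forall>x. 0 \<le> \<nu> x) \<and> (\<forall>x. \<nu> x = 0 \<longleftrightarrow> x = 0) \<and>
     (\<forall>a x. \<nu> (a *\<^sub>R x) = \<bar>a\<bar> * \<nu> x) \<and> (\<forall>x y. \<nu> (x + y) \<le> \<nu> x + \<nu> y)"

text \<open>Tuples \<open>(A, \<Gamma>, R, Q)\<close>; subtraction on the product type is componentwise.\<close>

type_synonym ('n, 'm, 'r) params =
  "((real, 'n) vec, 'n) vec \<times> ((real, 'n) vec, 'n) vec \<times>
   ((real, 'm) vec, 'm) vec \<times> ((real, 'r) vec, 'r) vec"

fun params_norm ::
  "(real^'n^'n \<Rightarrow> real) \<Rightarrow> (real^'m^'m \<Rightarrow> real) \<Rightarrow> (real^'r^'r \<Rightarrow> real) \<Rightarrow>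
   ('n::finite, 'm::finite, 'r::finite) params \<Rightarrow> real" where
  "params_norm \<nu>n \<nu>m \<nu>r (A, \<Gamma>, R, Q) = \<nu>n A + \<nu>n \<Gamma> + \<nu>m R + \<nu>r Q"

fun admissible :: "('n::finite, 'm::finite, 'r::finite) params \<Rightarrow> bool" where
  "admissible (A, \<Gamma>, R, Q) \<longleftrightarrow> sym_posdef \<Gamma> \<and> sym_posdef R \<and> sym_posdef Q"

fun tuple_of ::
  "('a \<Rightarrow> real^'n^'n) \<Rightarrow> ('b \<Rightarrow> real^'n^'n) \<Rightarrow> ('c \<Rightarrow> real^'m^'m) \<Rightarrow> ('d \<Rightarrow> real^'r^'r) \<Rightarrow>
   'a \<times> 'b \<times> 'c \<times> 'd \<Rightarrow> ('n::finite, 'm::finite, 'r::finite) params" where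
  "tuple_of A \<Gamma> R Q (a, g, \<rho>, q) = (A a, \<Gamma> g, R \<rho>, Q q)"

definition L2_on :: "real \<Rightarrow> (real \<Rightarrow> 'a::euclidean_space) \<Rightarrow> bool" where
  "L2_on T f \<longleftrightarrow> set_borel_measurable lebesgue {0..T} f \<and>
     set_integrable lebesgue {0..T} (\<lambda>t. (norm (f t))\<^sup>2)"

text \<open>\<open>f\<close> is the continuous representative of an element of \<open>H\<^sup>1(0,T)\<close> with weak derivative \<open>v\<close>.\<close>

definition H1_deriv :: "real \<Rightarrow> (real \<Rightarrow> 'a::euclidean_space) \<Rightarrow> (real \<Rightarrow> 'a) \<Rightarrow> bool" where
  "H1_deriv T f v \<longleftrightarrow> L2_on T v \<and> (\<forall>t\<in>{0..T}. f t = f 0 + (LINT s:{0..t}|lebesgue. v s))"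

fun riccati_solution ::
  "real \<Rightarrow> real^'m^'n \<Rightarrow> real^'n^'r \<Rightarrow> ('n::finite, 'm::finite, 'r::finite) params \<Rightarrow>
   (real \<Rightarrow> real^'n^'n) \<Rightarrow> bool" where
  "riccati_solution T B C (A, \<Gamma>, R, Q) \<Pi>s \<longleftrightarrow>
     \<Pi>s 0 = \<Gamma> \<and>
     (\<forall>t\<in>{0..T}. (\<Pi>s has_vector_derivative
        (A ** \<Pi>s t + \<Pi>s t ** transpose A
         - \<Pi>s t ** transpose C ** matrix_inv Q ** C ** \<Pi>s t
         + B ** R ** transpose B)) (at t within {0..T}))"

fun observer_solution ::
  "real \<Rightarrow> real^'n^'r \<Rightarrow> real^'n \<Rightarrow> (real \<Rightarrow> real^'r) \<Rightarrow>
   ('n::finite, 'm::finite, 'r::finite) params \<Rightarrow>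
   (real \<Rightarrow> real^'n^'n) \<Rightarrow> (real \<Rightarrow> real^'n) \<Rightarrow> bool" where
  "observer_solution T C x0 y (A, \<Gamma>, R, Q) \<Pi>s xh \<longleftrightarrow>
     xh 0 = x0 \<and>
     (\<exists>v. H1_deriv T xh v \<and>
        (AE t in lebesgue. t \<in> {0..T} \<longrightarrow>
           v t = A *v xh t + (\<Pi>s t ** transpose C ** matrix_inv Q) *v (y t - C *v xh t)))"

fun value_fun ::
  "real^'n^'r \<Rightarrow> (real \<Rightarrow> real^'r) \<Rightarrow> ('n::finite, 'm::finite, 'r::finite) params \<Rightarrow>
   (real \<Rightarrow> real^'n^'n) \<Rightarrow> (real \<Rightarrow> real^'n) \<Rightarrow> real \<Rightarrow> real^'n \<Rightarrow> real" where
  "value_fun C y (A, \<Gamma>, R, Q) \<Pi>s xh t x =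
     wnorm_sq (matrix_inv (\<Pi>s t)) (x - xh t)
     + (LINT s:{0..t}|lebesgue. wnorm_sq (matrix_inv Q) (y s - C *v xh s))"

definition max_cost :: "'s set \<Rightarrow> ('s \<Rightarrow> real \<Rightarrow> 'x \<Rightarrow> real) \<Rightarrow> real \<Rightarrow> 'x \<Rightarrow> real" where
  "max_cost \<Sigma> V t x = (MAX \<sigma>\<in>\<Sigma>. V \<sigma> t x)"

definition exp_cost ::
  "real \<Rightarrow> 's set \<Rightarrow> ('s \<Rightarrow> real \<Rightarrow> 'x \<Rightarrow> real) \<Rightarrow> real \<Rightarrow> 'x \<Rightarrow> real" where
  "exp_cost \<theta> \<Sigma> V t x = 1 / \<theta> * ln (1 / real (card \<Sigma>) * (\<Sum>\<sigma>\<in>\<Sigma>. exp (\<theta> * V \<sigma> t x)))"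

definition value_gap :: "'s set \<Rightarrow> ('s \<Rightarrow> real \<Rightarrow> 'x \<Rightarrow> real) \<Rightarrow> real \<Rightarrow> 'x \<Rightarrow> real" where
  "value_gap \<Sigma> V t x = (MAX (k, j)\<in>\<Sigma> \<times> \<Sigma>. V k t x - V j t x)"

definition uniform_mean :: "'s set \<Rightarrow> ('s \<Rightarrow> real) \<Rightarrow> real" where
  "uniform_mean \<Sigma> X = 1 / real (card \<Sigma>) * (\<Sum>\<sigma>\<in>\<Sigma>. X \<sigma>)"

end

theory Submission
  imports Defs
begin

text \<open>
Two facts are combined. Each of them has constants that depend on the parameters only through
a common spectral lower bound \<open>\<epsilon>\<close> and a common norm bound \<open>\<rho>\<close>, which exist on a compact set of admissible
parameters (\<open>compact_admissible_imp_uniformly_admissible\<close>); the number \<open>N\<close> of parameters never enters.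

First, the observers are Lipschitz in the parameters. The spectrum of a Riccati solution \<open>\<Pi>\<close> stays
between two positive numbers (\<open>riccati_solution_uniform_bounds\<close>). This follows from a barrier
argument: when an extreme eigenvalue touches an exponential barrier, the equation on its eigenvector involves
only that eigenvalue and the data, and it pushes the eigenvalue off the barrier. Hence the barriers can be
chosen uniformly.
On the resulting ball the Riccati field, the gain and the drift of the observer are
bounded and Lipschitz functions of the parameters and \<open>\<Pi>\<close>, and two applications of Gronwall's inequality
give \<open>\<parallel>x\<^sub>k t - x\<^sub>j t\<parallel> \<le> l \<cdot> \<parallel>S\<^sub>k - S\<^sub>j\<parallel>\<close> for the observer states (\<open>observer_solution_lipschitz\<close>).

Second, at a fixed time the value functions are quadratic functions with centres \<open>x\<^sub>k\<close> and
Hessians proportional to \<open>P\<^sub>k = \<Pi>\<^sub>k\<^sup>-\<^sup>1\<close>, pinched between positive constants \<open>\<alpha>\<close> and \<open>b\<close>. If a point \<open>x\<close> is farther from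
the reference state than \<open>b / \<alpha>\<close> times the largest distance of a centre from it, then all costs decrease
when \<open>x\<close> moves towards the reference state, so \<open>x\<close> minimises neither the maximum nor the exponential mean
(\<open>common_descent\<close>). For the sharper bound, the first-order condition of the exponential mean is a
weighted mean of the single gradients, and the normalised weights are at most \<open>exp (\<theta> J) / N\<close>
(\<open>exp_cost_minimiser_mean_bound\<close>).
\<close>

section \<open>Gronwall's inequality for absolutely continuous functions\<close>

text \<open>The right-hand side \<open>U t = a + b \<cdot> \<integral>\<^sub>0\<^sup>t u\<close> satisfies \<open>U' = b u \<le> b U\<close>, so \<open>U t \<cdot> exp (- b t)\<close>
does not increase.\<close>

lemma gronwall_integral:
  fixes u :: "real \<Rightarrow> real"
  assumes b: "0 \<le> b" and u: "continuous_on {0..T} u"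
    and le: "\<And>t. t \<in> {0..T} \<Longrightarrow> u t \<le> a + b * integral {0..t} u"
    and t: "t \<in> {0..T}"
  shows "u t \<le> a * exp (b * t)"
proof -
  define U where "U t = a + b * integral {0..t} u" for t
  define G where "G t = U t * exp (- (b * t))" for t
  have G': "(G has_real_derivative (b * u s - b * U s) * exp (- (b * s))) (at s within {0..T})"
    if "s \<in> {0..T}" for s
    unfolding G_def U_def
    by (auto intro!: derivative_eq_intros integral_has_real_derivative[OF u that] simp: algebra_simps)
  have "G t \<le> G 0"
  proof -
    have sub: "{0..t} \<subseteq> {0..T}" using t by auto
    have "\<exists>s\<in>{0..t}. G t - G 0 = (\<lambda>h. (b * u s - b * U s) * exp (- (b * s)) * h) (t - 0)"
    proof (rule mvt_very_simple)
      fix s assume "0 \<le> s" "s \<le> t"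
      then show "(G has_derivative (\<lambda>h. (b * u s - b * U s) * exp (- (b * s)) * h)) (at s within {0..t})"
        using has_field_derivative_subset[OF G' sub, of s] sub
        by (auto simp: has_field_derivative_def)
    qed (use t in auto)
    then obtain s where s: "s \<in> {0..t}"
      and eq: "G t - G 0 = (b * u s - b * U s) * exp (- (b * s)) * t" by auto
    have "u s \<le> U s" using le[of s] s sub by (auto simp: U_def)
    with b have "b * u s - b * U s \<le> 0" by (simp add: mult_left_mono)
    with t have "(b * u s - b * U s) * exp (- (b * s)) * t \<le> 0"
      by (simp add: mult_le_0_iff)
    with eq show ?thesis by simp
  qed
  then have "U t * exp (- (b * t)) \<le> a"
    by (simp add: G_def U_def)
  then have "U t \<le> a * exp (b * t)"
    by (simp add: exp_minus field_simps)
  with le[OF t] show ?thesis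
    by (simp add: U_def)
qed

text \<open>The form of Gronwall's inequality used for every trajectory below. The derivative \<open>v\<close> is only
controlled outside a null set, because the observer equation is driven by a square-integrable
output and holds almost everywhere.\<close>

lemma gronwall_absolutely_continuous:
  fixes f v :: "real \<Rightarrow> 'a::euclidean_space" and w :: "real \<Rightarrow> real"
  assumes v: "v integrable_on {0..T}"
    and f: "\<And>t. t \<in> {0..T} \<Longrightarrow> f t = f 0 + integral {0..t} v"
    and N: "negligible N"
    and bound: "\<And>s. s \<in> {0..T} - N \<Longrightarrow> norm (v s) \<le> b * norm (f s) + w s"
    and w: "w integrable_on {0..T}" "\<And>s. s \<in> {0..T} \<Longrightarrow> 0 \<le> w s"
    and b: "0 \<le> b" and t: "t \<in> {0..T}"
  shows "norm (f t) \<le> (norm (f 0) + integral {0..T} w) * exp (b * T)"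
proof -
  have "continuous_on {0..T} (\<lambda>t. f 0 + integral {0..t} v)"
    by (intro continuous_intros indefinite_integral_continuous_1 v)
  then have contf: "continuous_on {0..T} f"
    using f by (metis (no_types, lifting) continuous_on_cong)
  let ?a = "norm (f 0) + integral {0..T} w"
  have int_step: "norm (f t) \<le> ?a + b * integral {0..t} (\<lambda>s. norm (f s))" if t: "t \<in> {0..T}" for t
  proof -
    have sub: "{0..t} \<subseteq> {0..T}" using t by auto
    have iv: "v integrable_on {0..t}" and iw: "w integrable_on {0..t}"
      using integrable_on_subinterval[OF v sub] integrable_on_subinterval[OF w(1) sub] by auto
    have "continuous_on {0..t} (\<lambda>s. norm (f s))"
      using continuous_on_subset[OF contf sub] by (intro continuous_intros)
    then have inf: "(\<lambda>s. norm (f s)) integrable_on {0..t}"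
      by (rule integrable_continuous_real)
    define v' where "v' s = (if s \<in> N then 0 else v s)" for s
    have "integral {0..t} v = integral {0..t} v'"
      by (rule integral_spike[OF N]) (auto simp: v'_def)
    moreover have "norm (integral {0..t} v') \<le> integral {0..t} (\<lambda>s. b * norm (f s) + w s)"
    proof (rule integral_norm_bound_integral)
      show "v' integrable_on {0..t}"
        by (rule integrable_spike[OF iv N]) (auto simp: v'_def)
      show "(\<lambda>s. b * norm (f s) + w s) integrable_on {0..t}"
        by (intro integrable_add integrable_on_mult_right inf iw)
      fix s assume "s \<in> {0..t}"
      with sub have s: "s \<in> {0..T}" by blast
      show "norm (v' s) \<le> b * norm (f s) + w s"
        using bound[of s] w(2)[OF s] b s by (auto simp: v'_def)
    qed
    moreover have "integral {0..t} (\<lambda>s. b * norm (f s) + w s)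
        = b * integral {0..t} (\<lambda>s. norm (f s)) + integral {0..t} w"
      by (simp add: integral_add integrable_on_mult_right inf iw)
    moreover have "integral {0..t} w \<le> integral {0..T} w"
      by (rule integral_subset_le[OF sub iw w(1)]) (use w(2) in auto)
    ultimately show ?thesis
      using f[OF t] norm_triangle_ineq[of "f 0" "integral {0..t} v"] by simp
  qed
  have "0 \<le> integral {0..T} w"
    by (rule integral_nonneg[OF w(1)]) (use w(2) in auto)
  have "norm (f t) \<le> ?a * exp (b * t)"
    by (rule gronwall_integral[OF b _ int_step t]) (intro continuous_intros contf)
  also have "\<dots> \<le> ?a * exp (b * T)"
    using t b \<open>0 \<le> integral {0..T} w\<close> by (intro mult_left_mono) (auto intro: mult_left_mono)
  finally show ?thesis .
qed

section \<open>Matrix preliminaries\<close>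

lemma bounded_bilinear_matrix_vector_mult:
  "bounded_bilinear ((*v) :: real^'n^'m \<Rightarrow> real^'n \<Rightarrow> real^'m)"
  by (rule bilinear_conv_bounded_bilinear[THEN iffD1])
    (simp add: bilinear_def linear_iff matrix_vector_right_distrib matrix_vector_mult_add_rdistrib
      matrix_vector_mult_scaleR flip: scaleR_matrix_vector_assoc)

lemma bounded_bilinear_matrix_matrix_mult:
  "bounded_bilinear ((**) :: real^'n^'m \<Rightarrow> real^'p^'n \<Rightarrow> real^'p^'m)"
proof -
  have "(X + Y) ** Z = X ** Z + Y ** Z" for X Y :: "real^'n^'m" and Z :: "real^'p^'n"
    by (simp add: matrix_matrix_mult_def vec_eq_iff distrib_right sum.distrib)
  moreover have "(c *\<^sub>R X) ** Z = c *\<^sub>R (X ** Z)" "X ** (c *\<^sub>R Z) = c *\<^sub>R (X ** Z)"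
    for c and X :: "real^'n^'m" and Z :: "real^'p^'n"
    by (simp_all only: matrix_scalar_ac scalar_matrix_assoc)
  ultimately show ?thesis
    by (intro bilinear_conv_bounded_bilinear[THEN iffD1])
      (simp add: bilinear_def linear_iff matrix_add_ldistrib)
qed

lemma bounded_linear_transpose: "bounded_linear (transpose :: real^'n^'m \<Rightarrow> real^'m^'n)"
  by (rule linear_conv_bounded_linear[THEN iffD1]) (simp add: linear_iff transpose_def vec_eq_iff)

lemmas continuous_on_matrix_vector_mult [continuous_intros] =
  bounded_bilinear.continuous_on[OF bounded_bilinear_matrix_vector_mult]

lemma inner_transpose_matrix:
  fixes M :: "real^'n^'m"
  shows "x \<bullet> (transpose M *v y) = (M *v x) \<bullet> y"
  using dot_lmul_matrix[of x "transpose M" y] by (simp only: vector_transpose_matrix)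

lemma inner_symmetric_matrix:
  fixes M :: "real^'n^'n"
  assumes "transpose M = M"
  shows "x \<bullet> (M *v y) = (M *v x) \<bullet> y"
  using inner_transpose_matrix[of x M y] by (simp only: assms)

lemma quadratic_form_ge_of_sphere:
  fixes M :: "real^'n^'n"
  assumes "\<And>z. norm z = 1 \<Longrightarrow> c \<le> z \<bullet> (M *v z)"
  shows "c * (norm x)\<^sup>2 \<le> x \<bullet> (M *v x)"
proof (cases "x = 0")
  case False
  then have "c \<le> (x /\<^sub>R norm x) \<bullet> (M *v (x /\<^sub>R norm x))"
    by (intro assms) simp
  also have "\<dots> = x \<bullet> (M *v x) / (norm x)\<^sup>2"
    by (simp add: matrix_vector_mult_scaleR power2_eq_square field_simps)
  finally show ?thesis using False by (simp add: field_simps)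
qed simp

text \<open>A zero \<open>\<xi>\<close> of a nonnegative quadratic form minimises it, so the form cannot decrease along the
line from \<open>\<xi>\<close> in the direction \<open>- Y \<xi>\<close>; the linear term of the expansion along this line is
\<open>- 2 s \<parallel>Y \<xi>\<parallel>\<^sup>2\<close> and must therefore vanish.\<close>

lemma psd_quadratic_form_kernel:
  fixes Y :: "real^'n^'n"
  assumes sym: "transpose Y = Y" and psd: "\<And>z. 0 \<le> z \<bullet> (Y *v z)" and zero: "\<xi> \<bullet> (Y *v \<xi>) = 0"
  shows "Y *v \<xi> = 0"
proof -
  define z where "z = Y *v \<xi>"
  define c where "c = z \<bullet> (Y *v z)"
  have expand: "(\<xi> - s *\<^sub>R z) \<bullet> (Y *v (\<xi> - s *\<^sub>R z)) = s\<^sup>2 * c - 2 * s * (z \<bullet> z)" for s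
  proof -
    have "\<xi> \<bullet> (Y *v z) = z \<bullet> z"
      using inner_symmetric_matrix[OF sym, of \<xi> z] by (simp add: z_def)
    then show ?thesis
      using zero by (simp add: matrix_vector_mult_diff_distrib matrix_vector_mult_scaleR
          inner_diff inner_commute c_def power2_eq_square flip: z_def) (simp add: right_diff_distrib)
  qed
  have "c \<ge> 0" using psd c_def by simp
  have "z \<bullet> z \<le> 0"
  proof (cases "c = 0")
    case True
    then show ?thesis using psd[of "\<xi> - 1 *\<^sub>R z"] expand[of 1] by simp
  next
    case False
    have "0 \<le> ((z \<bullet> z) / c)\<^sup>2 * c - 2 * ((z \<bullet> z) / c) * (z \<bullet> z)"
      using psd expand by metis
    also have "\<dots> = - ((z \<bullet> z)\<^sup>2 / c)"
      using False by (simp add: field_simps power2_eq_square)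
    finally have "(z \<bullet> z)\<^sup>2 \<le> 0"
      using False \<open>c \<ge> 0\<close> by (simp add: divide_le_0_iff)
    then show ?thesis by simp
  qed
  then have "z = 0" by (metis inner_ge_zero inner_eq_zero_iff order_antisym)
  then show ?thesis by (simp add: z_def)
qed

lemma eigenvector_at_sphere_minimum:
  fixes X :: "real^'n^'n"
  assumes sym: "transpose X = X" and min: "\<And>z. norm z = 1 \<Longrightarrow> c \<le> z \<bullet> (X *v z)"
    and "norm \<xi> = 1" and le: "\<xi> \<bullet> (X *v \<xi>) \<le> c"
  shows "X *v \<xi> = c *\<^sub>R \<xi>"
proof -
  define Y where "Y = X - c *\<^sub>R mat 1"
  have Y: "Y *v z = X *v z - c *\<^sub>R z" for z
    by (simp add: Y_def matrix_vector_mult_diff_rdistrib flip: scaleR_matrix_vector_assoc)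
  have tr: "transpose Y = Y"
    unfolding Y_def linear_diff[OF bounded_linear.linear[OF bounded_linear_transpose]]
    by (simp add: transpose_scalar sym)
  have psd: "0 \<le> z \<bullet> (Y *v z)" for z
    using quadratic_form_ge_of_sphere[where M=X and c=c and x=z, OF min]
    by (simp add: Y inner_diff_right power2_norm_eq_inner)
  have "\<xi> \<bullet> (Y *v \<xi>) = 0"
    using min[OF \<open>norm \<xi> = 1\<close>] le \<open>norm \<xi> = 1\<close>
    by (simp add: Y inner_diff_right norm_eq_1)
  from psd_quadratic_form_kernel[OF tr psd this] show ?thesis by (simp add: Y)
qed

section \<open>A barrier for the smallest eigenvalue\<close>

text \<open>A maximum principle for matrix flows: to keep all eigenvalues of \<open>X t\<close> above a scalar barrier
\<open>\<phi> t\<close> it is enough to look at vectors that are eigenvectors for the eigenvalue \<open>\<phi> t\<close>. At the first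
time \<open>s\<close> at which the Rayleigh quotient touches the barrier, the touching unit vector \<open>\<xi>1\<close> minimises
the Rayleigh quotient and so is such an eigenvector; the strict derivative inequality then
says that the quotient at \<open>\<xi>1\<close> lay below the barrier just before \<open>s\<close>.\<close>

lemma symmetric_matrix_barrier:
  fixes X X' :: "real \<Rightarrow> real^'n^'n" and \<phi> \<phi>' :: "real \<Rightarrow> real"
  assumes X: "\<And>t. t \<in> {0..T} \<Longrightarrow> (X has_vector_derivative X' t) (at t within {0..T})"
    and sym: "\<And>t. t \<in> {0..T} \<Longrightarrow> transpose (X t) = X t"
    and \<phi>: "\<And>t. t \<in> {0..T} \<Longrightarrow> (\<phi> has_real_derivative \<phi>' t) (at t within {0..T})"
    and init: "\<And>\<xi>. norm \<xi> = 1 \<Longrightarrow> \<phi> 0 < \<xi> \<bullet> (X 0 *v \<xi>)"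
    and step: "\<And>t \<xi>. t \<in> {0..T} \<Longrightarrow> norm \<xi> = 1 \<Longrightarrow> X t *v \<xi> = \<phi> t *\<^sub>R \<xi>
      \<Longrightarrow> \<phi>' t < \<xi> \<bullet> (X' t *v \<xi>)"
    and t: "t \<in> {0..T}" and \<xi>: "norm \<xi> = 1"
  shows "\<phi> t < \<xi> \<bullet> (X t *v \<xi>)"
proof (rule ccontr)
  assume neg: "\<not> ?thesis"
  have contX: "continuous_on {0..T} X"
    by (rule continuous_on_vector_derivative[OF X])
  have cont\<phi>: "continuous_on {0..T} \<phi>"
    by (rule DERIV_continuous_on[OF \<phi>])
  define g where "g p = snd p \<bullet> (X (fst p) *v snd p) - \<phi> (fst p)" for p :: "real \<times> (real^'n)"
  define S where "S = {0..T} \<times> sphere (0::real^'n) 1"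
  have gS: "continuous_on S g"
  proof -
    have "continuous_on S (\<lambda>p. X (fst p))" "continuous_on S (\<lambda>p. \<phi> (fst p))"
      by (rule continuous_on_compose2[OF contX] continuous_on_compose2[OF cont\<phi>],
          auto simp: S_def intro: continuous_intros)+
    then show ?thesis
      unfolding g_def by (intro continuous_intros continuous_on_matrix_vector_mult)
  qed
  have "compact S" unfolding S_def by (intro compact_Times) auto
  then have "closed (S \<inter> g -` {..0})"
    by (intro continuous_closed_preimage[OF gS] compact_imp_closed[of S] closed_atMost)
  with \<open>compact S\<close> have "compact (S \<inter> (S \<inter> g -` {..0}))"
    by (rule compact_Int_closed)
  also have "S \<inter> (S \<inter> g -` {..0}) = {p \<in> S. g p \<le> 0}" by auto
  finally have compZ: "compact (fst ` {p \<in> S. g p \<le> 0})"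
    by (intro compact_continuous_image continuous_intros)
  have "t \<in> fst ` {p \<in> S. g p \<le> 0}"
    by (rule image_eqI[of _ _ "(t, \<xi>)"]) (use neg t \<xi> in \<open>auto simp: S_def g_def\<close>)
  then have "fst ` {p \<in> S. g p \<le> 0} \<noteq> {}" by blast
  from compact_attains_inf[OF compZ this] obtain s where
    "s \<in> fst ` {p \<in> S. g p \<le> 0}" and first: "\<forall>r \<in> fst ` {p \<in> S. g p \<le> 0}. s \<le> r"
    by blast
  then obtain \<xi>1 where p: "(s, \<xi>1) \<in> S" "g (s, \<xi>1) \<le> 0"
    by auto
  have s: "s \<in> {0..T}" and \<xi>1: "norm \<xi>1 = 1" and le: "g (s, \<xi>1) \<le> 0"
    using p by (auto simp: S_def)
  have before: "0 < g (r, z)" if "r \<in> {0..<s}" "norm z = 1" for r z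
  proof (rule ccontr)
    assume "\<not> 0 < g (r, z)"
    then have "r \<in> fst ` {p \<in> S. g p \<le> 0}"
      by (intro image_eqI[of _ _ "(r, z)"]) (use that s in \<open>auto simp: S_def\<close>)
    with first that(1) show False by force
  qed
  have "s \<noteq> 0" using init[OF \<xi>1] le by (auto simp: g_def)
  with s have "0 < s" by simp
  \<comment> \<open>the strict inequality before \<open>s\<close> passes to the limit from the left\<close>
  have at_s: "0 \<le> g (s, z)" if z: "norm z = 1" for z
  proof -
    have "continuous_on {0..s} (\<lambda>r. g (r, z))"
      by (rule continuous_on_compose2[OF gS]) (use s z in \<open>auto simp: S_def intro!: continuous_intros\<close>)
    then have "((\<lambda>r. g (r, z)) \<longlongrightarrow> g (s, z)) (at_left s)"
      using \<open>0 < s\<close> by (auto simp: continuous_on_def dest!: bspec[of _ _ s] simp: at_within_Icc_at_left)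
    moreover have "eventually (\<lambda>r. 0 \<le> g (r, z)) (at_left s)"
      using eventually_at_left_real[OF \<open>0 < s\<close>]
      by eventually_elim (use before z in \<open>force intro: less_imp_le\<close>)
    ultimately show ?thesis
      by (rule tendsto_lowerbound) simp
  qed
  have eig: "X s *v \<xi>1 = \<phi> s *\<^sub>R \<xi>1"
    by (rule eigenvector_at_sphere_minimum[OF sym[OF s] _ \<xi>1])
      (use at_s le in \<open>auto simp: g_def\<close>)
  have "((\<lambda>r. g (r, \<xi>1)) has_real_derivative (\<xi>1 \<bullet> (X' s *v \<xi>1) - \<phi>' s)) (at s within {0..T})"
  proof -
    have "bounded_linear (\<lambda>M::real^'n^'n. \<xi>1 \<bullet> (M *v \<xi>1))"
      by (intro bounded_linear_intros bounded_bilinear.bounded_linear_left[OF bounded_bilinear_matrix_vector_mult])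
    from bounded_linear.has_vector_derivative[OF this X[OF s]]
    have "((\<lambda>r. \<xi>1 \<bullet> (X r *v \<xi>1)) has_real_derivative (\<xi>1 \<bullet> (X' s *v \<xi>1))) (at s within {0..T})"
      by (simp add: has_real_derivative_iff_has_vector_derivative)
    from DERIV_diff[OF this \<phi>[OF s]] show ?thesis by (simp add: g_def)
  qed
  moreover have "0 < \<xi>1 \<bullet> (X' s *v \<xi>1) - \<phi>' s"
    using step[OF s \<xi>1 eig] by simp
  ultimately obtain d where "d > 0"
    and dec: "\<And>h. h > 0 \<Longrightarrow> s - h \<in> {0..T} \<Longrightarrow> h < d \<Longrightarrow> g (s - h, \<xi>1) < g (s, \<xi>1)"
    using has_real_derivative_pos_inc_left by blast
  define h where "h = min (s / 2) (d / 2)"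
  have h: "0 < h" "s - h \<in> {0..<s}" "s - h \<in> {0..T}" "h < d"
    using \<open>0 < s\<close> \<open>d > 0\<close> s by (auto simp: h_def min_def)
  show False
    using dec[OF h(1,3,4)] before[OF h(2) \<xi>1] le by simp
qed

section \<open>Bounded Lipschitz maps\<close>

text \<open>Products of bounded Lipschitz maps are again bounded Lipschitz, unlike products of Lipschitz maps.
This closure property gives Lipschitz constants for the Riccati field and the observer gains
without computing them.\<close>

definition bounded_lipschitz_on :: "'a::metric_space set \<Rightarrow> ('a \<Rightarrow> 'b::real_normed_vector) \<Rightarrow> bool" where
  "bounded_lipschitz_on D f \<longleftrightarrow> bounded (f ` D) \<and> (\<exists>L. L-lipschitz_on D f)"

lemma bounded_lipschitz_onE:
  assumes "bounded_lipschitz_on D f"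
  obtains c where "0 \<le> c" "\<And>x. x \<in> D \<Longrightarrow> norm (f x) \<le> c"
    "\<And>x y. x \<in> D \<Longrightarrow> y \<in> D \<Longrightarrow> norm (f x - f y) \<le> c * dist x y"
proof -
  obtain b where b: "\<And>x. x \<in> D \<Longrightarrow> norm (f x) \<le> b"
    using assms unfolding bounded_lipschitz_on_def bounded_iff by auto
  obtain L where L: "L-lipschitz_on D f"
    using assms unfolding bounded_lipschitz_on_def by auto
  show thesis
  proof (rule that[of "max b L"])
    show "0 \<le> max b L" using lipschitz_on_nonneg[OF L] by simp
    show "norm (f x) \<le> max b L" if "x \<in> D" for x
      using b[OF that] by simp
    show "norm (f x - f y) \<le> max b L * dist x y" if "x \<in> D" "y \<in> D" for x y
      using lipschitz_onD[OF L that] mult_right_mono[of L "max b L" "dist x y"]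
      by (simp add: dist_norm)
  qed
qed

lemma bounded_lipschitz_onI:
  assumes "\<And>x. x \<in> D \<Longrightarrow> norm (f x) \<le> c" "0 \<le> L"
    and "\<And>x y. x \<in> D \<Longrightarrow> y \<in> D \<Longrightarrow> norm (f x - f y) \<le> L * dist x y"
  shows "bounded_lipschitz_on D f"
  unfolding bounded_lipschitz_on_def bounded_iff
proof
  show "\<exists>b. \<forall>y\<in>f ` D. norm y \<le> b" using assms(1) by auto
  show "\<exists>L. L-lipschitz_on D f"
    using assms(2,3) by (intro exI[of _ L] lipschitz_onI) (auto simp: dist_norm)
qed

lemma bounded_lipschitz_on_prodE:
  assumes "bounded_lipschitz_on (D \<times> E) (\<lambda>p. f (fst p) (snd p))"
  obtains c where "0 \<le> c" "\<And>x y. x \<in> D \<Longrightarrow> y \<in> E \<Longrightarrow> norm (f x y) \<le> c"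
    "\<And>x x' y y'. x \<in> D \<Longrightarrow> x' \<in> D \<Longrightarrow> y \<in> E \<Longrightarrow> y' \<in> E \<Longrightarrow>
       norm (f x y - f x' y') \<le> c * (dist x x' + dist y y')"
proof (rule bounded_lipschitz_onE[OF assms])
  fix c :: real
  assume c: "0 \<le> c" "\<And>p. p \<in> D \<times> E \<Longrightarrow> norm (f (fst p) (snd p)) \<le> c"
    "\<And>p q. p \<in> D \<times> E \<Longrightarrow> q \<in> D \<times> E \<Longrightarrow>
       norm (f (fst p) (snd p) - f (fst q) (snd q)) \<le> c * dist p q"
  have "norm (f x y - f x' y') \<le> c * (dist x x' + dist y y')"
    if "x \<in> D" "x' \<in> D" "y \<in> E" "y' \<in> E" for x x' y y'
  proof -
    have "norm (f x y - f x' y') \<le> c * dist (x, y) (x', y')"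
      using c(3)[of "(x, y)" "(x', y')"] that by simp
    also have "\<dots> \<le> c * (dist x x' + dist y y')"
      unfolding dist_Pair_Pair using c(1) by (intro mult_left_mono sqrt_sum_squares_le_sum) auto
    finally show ?thesis .
  qed
  with c(1) c(2)[of "(_, _)"] show thesis by (intro that[of c]) auto
qed

lemma bounded_lipschitz_on_const: "bounded_lipschitz_on D (\<lambda>x. a)"
  by (rule bounded_lipschitz_onI[where c="norm a" and L=0]) auto

lemma bounded_lipschitz_on_add:
  assumes "bounded_lipschitz_on D f" "bounded_lipschitz_on D g"
  shows "bounded_lipschitz_on D (\<lambda>x. f x + g x)"
  using assms bounded_plus_comp[of f D g] lipschitz_on_add[of _ D f _ g]
  unfolding bounded_lipschitz_on_def by blast

lemma bounded_lipschitz_on_diff: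
  assumes "bounded_lipschitz_on D f" "bounded_lipschitz_on D g"
  shows "bounded_lipschitz_on D (\<lambda>x. f x - g x)"
  using assms bounded_minus_comp[of f D g] lipschitz_on_diff[of _ D f _ g]
  unfolding bounded_lipschitz_on_def by blast

lemma bounded_lipschitz_on_linear:
  assumes h: "bounded_linear h" and f: "bounded_lipschitz_on D f"
  shows "bounded_lipschitz_on D (\<lambda>x. h (f x))"
proof -
  obtain c where c: "0 \<le> c" "\<And>x. x \<in> D \<Longrightarrow> norm (f x) \<le> c"
    "\<And>x y. x \<in> D \<Longrightarrow> y \<in> D \<Longrightarrow> norm (f x - f y) \<le> c * dist x y"
    using bounded_lipschitz_onE[OF f] by blast
  obtain k where k: "0 \<le> k" "\<And>x. norm (h x) \<le> k * norm x"
    using bounded_linear.nonneg_bounded[OF h] by (metis mult.commute)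
  show ?thesis
  proof (rule bounded_lipschitz_onI)
    show "norm (h (f x)) \<le> k * c" if "x \<in> D" for x
      using k(2)[of "f x"] mult_left_mono[OF c(2)[OF that] k(1)] by linarith
    show "norm (h (f x) - h (f y)) \<le> k * c * dist x y" if "x \<in> D" "y \<in> D" for x y
      using k(2)[of "f x - f y"] mult_left_mono[OF c(3)[OF that] k(1)]
      by (simp add: bounded_linear.linear[OF h] linear_diff mult.assoc)
  qed (use k c in simp)
qed

lemma bounded_lipschitz_on_bilinear:
  assumes h: "bounded_bilinear h" and f: "bounded_lipschitz_on D f" and g: "bounded_lipschitz_on D g"
  shows "bounded_lipschitz_on D (\<lambda>x. h (f x) (g x))"
proof -
  obtain c where c: "0 \<le> c" "\<And>x. x \<in> D \<Longrightarrow> norm (f x) \<le> c"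
    "\<And>x y. x \<in> D \<Longrightarrow> y \<in> D \<Longrightarrow> norm (f x - f y) \<le> c * dist x y"
    using bounded_lipschitz_onE[OF f] by blast
  obtain d where d: "0 \<le> d" "\<And>x. x \<in> D \<Longrightarrow> norm (g x) \<le> d"
    "\<And>x y. x \<in> D \<Longrightarrow> y \<in> D \<Longrightarrow> norm (g x - g y) \<le> d * dist x y"
    using bounded_lipschitz_onE[OF g] by blast
  obtain k where k: "0 \<le> k" "\<And>x y. norm (h x y) \<le> norm x * norm y * k"
    using bounded_bilinear.nonneg_bounded[OF h] by metis
  show ?thesis
  proof (rule bounded_lipschitz_onI)
    show "norm (h (f x) (g x)) \<le> c * d * k" if "x \<in> D" for x
      using mult_right_mono[OF mult_mono[OF c(2) d(2)] k(1), of x x] that c(1) k(2)[of "f x" "g x"]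
      by simp
    show "norm (h (f x) (g x) - h (f y) (g y)) \<le> 2 * (c * d * k) * dist x y"
      if xy: "x \<in> D" "y \<in> D" for x y
    proof -
      have "norm (h (f x - f y) (g x)) \<le> (c * dist x y) * d * k"
        by (intro order_trans[OF k(2)] mult_right_mono mult_mono)
          (use c d k xy in auto)
      moreover have "norm (h (f y) (g x - g y)) \<le> c * (d * dist x y) * k"
        by (intro order_trans[OF k(2)] mult_right_mono mult_mono)
          (use c d k xy in auto)
      moreover have "h (f x) (g x) - h (f y) (g y) = h (f x - f y) (g x) + h (f y) (g x - g y)"
        by (simp add: bounded_bilinear.diff_left[OF h] bounded_bilinear.diff_right[OF h])
      ultimately show ?thesis
        using norm_triangle_ineq[of "h (f x - f y) (g x)" "h (f y) (g x - g y)"]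
        by (simp add: mult_ac)
    qed
  qed (use k c d in simp)
qed

lemma bounded_lipschitz_on_ident: "bounded D \<Longrightarrow> bounded_lipschitz_on D (\<lambda>x. x)"
  unfolding bounded_lipschitz_on_def using lipschitz_on_id by force

lemmas bounded_lipschitz_on_mult_matrix =
  bounded_lipschitz_on_bilinear[OF bounded_bilinear_matrix_matrix_mult]
lemmas bounded_lipschitz_on_transpose =
  bounded_lipschitz_on_linear[OF bounded_linear_transpose]

section \<open>Coercive matrices\<close>

text \<open>Positive definiteness with an explicit lower bound on the spectrum, the form in which
it can be made uniform over a family of matrices.\<close>

definition coercive :: "real \<Rightarrow> real^'n^'n \<Rightarrow> bool" where
  "coercive \<epsilon> M \<longleftrightarrow> transpose M = M \<and> (\<forall>x. \<epsilon> * (norm x)\<^sup>2 \<le> x \<bullet> (M *v x))"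

lemma norm_matrix_vector_mult_le:
  fixes M :: "real^'n^'m"
  shows "norm (M *v x) \<le> norm M * norm x"
proof -
  have "norm (M *v x) = L2_set (\<lambda>i. \<bar>M $ i \<bullet> x\<bar>) UNIV"
    by (simp add: norm_vec_def matrix_vector_mul_component)
  also have "\<dots> \<le> L2_set (\<lambda>i. norm (M $ i) * norm x) UNIV"
    by (intro L2_set_mono) (auto simp: Cauchy_Schwarz_ineq2)
  also have "\<dots> = norm M * norm x"
    by (simp add: norm_vec_def L2_set_left_distrib)
  finally show ?thesis .
qed

lemma quadratic_form_le_norm:
  fixes M :: "real^'n^'n"
  shows "\<bar>x \<bullet> (M *v x)\<bar> \<le> norm M * (norm x)\<^sup>2"
proof -
  have "\<bar>x \<bullet> (M *v x)\<bar> \<le> norm x * norm (M *v x)" by (rule Cauchy_Schwarz_ineq2)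
  also have "\<dots> \<le> norm x * (norm M * norm x)"
    by (intro mult_left_mono norm_matrix_vector_mult_le) simp
  finally show ?thesis by (simp add: power2_eq_square mult_ac)
qed

lemma norm_symmetric_matrix_le:
  fixes M :: "real^'n^'n"
  assumes sym: "transpose M = M" and b: "\<And>x. norm (M *v x) \<le> b * norm x"
  shows "norm M \<le> real CARD('n) * b"
proof -
  have "M $ i = M *v axis i 1" for i
    by (subst (1) sym[symmetric])
      (simp add: matrix_vector_mult_basis column_def transpose_def vec_eq_iff)
  then have "norm (M $ i) \<le> b" for i
    using b[of "axis i 1"] by simp
  then have "(\<Sum>i\<in>UNIV. norm (M $ i)) \<le> real CARD('n) * b"
    using sum_bounded_above[of UNIV "\<lambda>i. norm (M $ i)" b] by simp
  moreover have "norm M \<le> (\<Sum>i\<in>UNIV. norm (M $ i))"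
    unfolding norm_vec_def by (rule L2_set_le_sum) simp
  ultimately show ?thesis by linarith
qed

text \<open>Polarisation: for \<open>u\<close> parallel to \<open>M x\<close> and as long as \<open>x\<close>, the number \<open>u \<bullet> M x = \<parallel>x\<parallel> \<parallel>M x\<parallel>\<close> is a
combination of the quadratic form at \<open>u + x\<close> and \<open>u - x\<close>.\<close>

lemma symmetric_matrix_operator_bound:
  fixes M :: "real^'n^'n"
  assumes sym: "transpose M = M" and b: "\<And>x. \<bar>x \<bullet> (M *v x)\<bar> \<le> b * (norm x)\<^sup>2"
  shows "norm (M *v x) \<le> b * norm x"
proof (cases "x = 0 \<or> M *v x = 0")
  case True
  have "0 \<le> b"
    using b[of "axis undefined 1"] by (simp add: norm_axis_1) 
  with True show ?thesis by auto
next
  case False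
  define u where "u = (norm x / norm (M *v x)) *\<^sub>R (M *v x)"
  have nu: "norm u = norm x" using False by (simp add: u_def)
  have "4 * (u \<bullet> (M *v x)) = (u + x) \<bullet> (M *v (u + x)) - (u - x) \<bullet> (M *v (u - x))"
    using inner_symmetric_matrix[OF sym, of u x]
    by (simp add: matrix_vector_right_distrib matrix_vector_mult_diff_distrib
        inner_add inner_diff inner_commute)
  also have "\<dots> \<le> b * (norm (u + x))\<^sup>2 + b * (norm (u - x))\<^sup>2"
    using b[of "u + x"] b[of "u - x"] by linarith
  also have "\<dots> = b * (2 * (u \<bullet> u) + 2 * (x \<bullet> x))"
    unfolding power2_norm_eq_inner
    by (simp add: inner_add inner_diff inner_commute) (simp add: algebra_simps)
  also have "\<dots> = 4 * (b * norm x * norm x)"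
    using nu by (simp add: power2_norm_eq_inner[symmetric] power2_eq_square)
  also have "u \<bullet> (M *v x) = norm x * norm (M *v x)"
    using False by (simp add: u_def power2_norm_eq_inner[symmetric] power2_eq_square)
  finally show ?thesis using False by (simp add: mult_ac)
qed

context
  fixes \<epsilon> :: real and M :: "real^'n^'n"
  assumes M: "coercive \<epsilon> M" and \<epsilon>: "0 < \<epsilon>"
begin

lemma coercive_norm_lower: "\<epsilon> * norm x \<le> norm (M *v x)"
proof (cases "x = 0")
  case False
  have "\<epsilon> * (norm x)\<^sup>2 \<le> norm x * norm (M *v x)"
    using M norm_cauchy_schwarz[of x "M *v x"] unfolding coercive_def by (meson order_trans)
  then have "norm x * (\<epsilon> * norm x) \<le> norm x * norm (M *v x)"
    by (simp add: power2_eq_square mult_ac)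
  then show ?thesis using False by simp
qed simp

lemma coercive_matrix_inv: "M ** matrix_inv M = mat 1" "matrix_inv M ** M = mat 1"
proof -
  have "\<forall>x. M *v x = 0 \<longrightarrow> x = 0"
    using coercive_norm_lower \<epsilon> by (metis mult_le_0_iff norm_le_zero_iff norm_zero not_le)
  then have "invertible M"
    by (simp add: invertible_left_inverse matrix_left_invertible_ker)
  then have "\<exists>N. M ** N = mat 1 \<and> N ** M = mat 1"
    by (simp add: invertible_def)
  from someI_ex[OF this] show "M ** matrix_inv M = mat 1" "matrix_inv M ** M = mat 1"
    unfolding matrix_inv_def by auto
qed

lemma coercive_mult_matrix_inv: "M *v (matrix_inv M *v x) = x"
  by (simp add: matrix_vector_mul_assoc coercive_matrix_inv)

lemma transpose_matrix_inv_coercive: "transpose (matrix_inv M) = matrix_inv M"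
proof -
  have "transpose (matrix_inv M) ** M = mat 1"
    using arg_cong[OF coercive_matrix_inv(1), of transpose] M
    by (simp add: matrix_transpose_mul coercive_def)
  then have "transpose (matrix_inv M) ** (M ** matrix_inv M) = matrix_inv M"
    by (simp add: matrix_mul_assoc)
  then show ?thesis by (simp add: coercive_matrix_inv)
qed

lemma norm_matrix_inv_vector_le: "norm (matrix_inv M *v x) \<le> (1 / \<epsilon>) * norm x"
  using coercive_norm_lower[of "matrix_inv M *v x"] \<epsilon>
  by (simp add: coercive_mult_matrix_inv field_simps)

lemma norm_matrix_inv_le: "norm (matrix_inv M) \<le> real CARD('n) * (1 / \<epsilon>)"
  using transpose_matrix_inv_coercive norm_matrix_inv_vector_le by (rule norm_symmetric_matrix_le)

lemma coercive_inv_quadratic_form: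
  "x \<bullet> (matrix_inv M *v x) = (matrix_inv M *v x) \<bullet> (M *v (matrix_inv M *v x))"
  by (simp add: coercive_mult_matrix_inv inner_commute)

lemma matrix_inv_quadratic_form_nonneg: "0 \<le> x \<bullet> (matrix_inv M *v x)"
proof -
  have "0 \<le> \<epsilon> * (norm (matrix_inv M *v x))\<^sup>2" using \<epsilon> by simp
  also have "\<dots> \<le> x \<bullet> (matrix_inv M *v x)"
    using M unfolding coercive_inv_quadratic_form coercive_def by blast
  finally show ?thesis .
qed

lemma matrix_inv_quadratic_form_le: "x \<bullet> (matrix_inv M *v x) \<le> (1 / \<epsilon>) * (norm x)\<^sup>2"
proof -
  have "x \<bullet> (matrix_inv M *v x) \<le> norm x * norm (matrix_inv M *v x)"
    by (rule norm_cauchy_schwarz)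
  also have "\<dots> \<le> norm x * ((1 / \<epsilon>) * norm x)"
    by (intro mult_left_mono norm_matrix_inv_vector_le) simp
  finally show ?thesis by (simp add: power2_eq_square mult_ac)
qed

lemma coercive_matrix_inv_of_norm_le:
  assumes b: "\<And>x. norm (M *v x) \<le> b * norm x" and "0 < b"
  shows "coercive (\<epsilon> / b\<^sup>2) (matrix_inv M)"
  unfolding coercive_def
proof (intro conjI allI)
  fix x
  have "norm x \<le> b * norm (matrix_inv M *v x)"
    using b[of "matrix_inv M *v x"] by (simp add: coercive_mult_matrix_inv)
  then have "(norm x)\<^sup>2 \<le> (b * norm (matrix_inv M *v x))\<^sup>2"
    by (intro power_mono) auto
  then have "\<epsilon> / b\<^sup>2 * (norm x)\<^sup>2 \<le> \<epsilon> * (norm (matrix_inv M *v x))\<^sup>2"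
    using \<epsilon> \<open>0 < b\<close> by (simp add: field_simps power_mult_distrib)
  also have "\<dots> \<le> x \<bullet> (matrix_inv M *v x)"
    using M unfolding coercive_inv_quadratic_form coercive_def by blast
  finally show "\<epsilon> / b\<^sup>2 * (norm x)\<^sup>2 \<le> x \<bullet> (matrix_inv M *v x)" .
qed (rule transpose_matrix_inv_coercive)

end

lemma bounded_lipschitz_on_matrix_inv:
  fixes f :: "'a::metric_space \<Rightarrow> real^'n^'n"
  assumes f: "bounded_lipschitz_on D f" and co: "\<And>x. x \<in> D \<Longrightarrow> coercive \<epsilon> (f x)" and \<epsilon>: "0 < \<epsilon>"
  shows "bounded_lipschitz_on D (\<lambda>x. matrix_inv (f x))"
proof -
  obtain c where c: "0 \<le> c" "\<And>x. x \<in> D \<Longrightarrow> norm (f x) \<le> c"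
    "\<And>x y. x \<in> D \<Longrightarrow> y \<in> D \<Longrightarrow> norm (f x - f y) \<le> c * dist x y"
    using bounded_lipschitz_onE[OF f] by blast
  obtain k where k: "0 \<le> k" "\<And>(X::real^'n^'n) (Y::real^'n^'n). norm (X ** Y) \<le> norm X * norm Y * k"
    using bounded_bilinear.nonneg_bounded[OF bounded_bilinear_matrix_matrix_mult] by metis
  define b where "b = real CARD('n) * (1 / \<epsilon>)"
  have b: "norm (matrix_inv (f x)) \<le> b" if "x \<in> D" for x
    unfolding b_def by (rule norm_matrix_inv_le[OF co[OF that] \<epsilon>])
  have "0 \<le> b" using \<epsilon> by (simp add: b_def)
  show ?thesis
  proof (rule bounded_lipschitz_onI[OF b])
    fix x y assume x: "x \<in> D" and y: "y \<in> D"
    let ?X = "matrix_inv (f x)" and ?Y = "matrix_inv (f y)"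
    \<comment> \<open>the resolvent identity\<close>
    have "?X - ?Y = ?X ** (f y - f x) ** ?Y"
      by (simp add: bounded_bilinear.diff_left[OF bounded_bilinear_matrix_matrix_mult]
          bounded_bilinear.diff_right[OF bounded_bilinear_matrix_matrix_mult]
          coercive_matrix_inv[OF co[OF x] \<epsilon>] coercive_matrix_inv[OF co[OF y] \<epsilon>]
          flip: matrix_mul_assoc)
    also have "norm \<dots> \<le> (norm ?X * norm (f y - f x) * k) * norm ?Y * k"
      by (intro order_trans[OF k(2)] mult_right_mono k) auto
    also have "\<dots> \<le> (b * (c * dist x y) * k) * b * k"
      by (intro mult_right_mono mult_mono b x y k order_trans[OF c(3)[OF y x]])
        (use \<open>0 \<le> b\<close> c k in \<open>auto simp: dist_commute\<close>)
    finally show "norm (?X - ?Y) \<le> (b * c * k * b * k) * dist x y"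
      by (simp add: mult_ac)
  qed (use c k \<open>0 \<le> b\<close> in auto)
qed

section \<open>Uniformly admissible parameters\<close>

text \<open>The quantitative form of admissibility that a compact set of parameters satisfies. All later constants
depend on the parameters only through \<open>\<epsilon>\<close> and \<open>\<rho>\<close>, which is what makes them independent of the
number of parameters.\<close>

fun uniformly_admissible :: "real \<Rightarrow> real \<Rightarrow> ('n::finite, 'm::finite, 'r::finite) params \<Rightarrow> bool" where
  "uniformly_admissible \<epsilon> \<rho> (A, \<Gamma>, R, Q) \<longleftrightarrow>
     norm (A, \<Gamma>, R, Q) \<le> \<rho> \<and> coercive \<epsilon> \<Gamma> \<and> coercive \<epsilon> R \<and> coercive \<epsilon> Q"

lemma coercive_mono: "coercive \<epsilon> M \<Longrightarrow> \<delta> \<le> \<epsilon> \<Longrightarrow> coercive \<delta> M"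
  unfolding coercive_def by (meson mult_right_mono order_trans zero_le_power2)

lemma compact_sym_posdef_imp_coercive:
  fixes S :: "(real^'n^'n) set"
  assumes "compact S" and pd: "\<And>M. M \<in> S \<Longrightarrow> sym_posdef M"
  obtains \<epsilon> where "0 < \<epsilon>" "\<And>M. M \<in> S \<Longrightarrow> coercive \<epsilon> M"
proof (cases "S = {}")
  case True
  then show thesis using that[of 1] by simp
next
  case False
  define f where "f p = snd p \<bullet> (fst p *v snd p)" for p :: "(real^'n^'n) \<times> (real^'n)"
  let ?D = "S \<times> sphere (0::real^'n) 1"
  have "compact ?D" by (intro compact_Times assms(1)) simp
  moreover have "?D \<noteq> {}" using False by simp
  moreover have "continuous_on ?D f" unfolding f_def by (intro continuous_intros)
  ultimately obtain p where p: "p \<in> ?D" and min: "\<forall>q\<in>?D. f p \<le> f q"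
    using continuous_attains_inf by blast
  have "snd p \<noteq> 0" using p by (auto simp: mem_Times_iff)
  then have "0 < f p"
    using pd[of "fst p"] p by (auto simp: f_def sym_posdef_def mem_Times_iff)
  moreover have "coercive (f p) M" if "M \<in> S" for M
    unfolding coercive_def
  proof (intro conjI allI)
    show "transpose M = M" using pd[OF that] by (simp add: sym_posdef_def)
    show "f p * (norm x)\<^sup>2 \<le> x \<bullet> (M *v x)" for x
    proof (rule quadratic_form_ge_of_sphere)
      fix z :: "real^'n" assume "norm z = 1"
      with that have "(M, z) \<in> ?D" by simp
      with min have "f p \<le> f (M, z)" by blast
      then show "f p \<le> z \<bullet> (M *v z)" by (simp add: f_def)
    qed
  qed
  ultimately show thesis by (rule that)
qed

lemma compact_admissible_imp_uniformly_admissible: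
  fixes K :: "('n::finite, 'm::finite, 'r::finite) params set"
  assumes K: "compact K" and adm: "\<forall>S\<in>K. admissible S"
  obtains \<epsilon> \<rho> where "0 < \<epsilon>" "0 < \<rho>" "\<And>S. S \<in> K \<Longrightarrow> uniformly_admissible \<epsilon> \<rho> S"
proof -
  obtain \<epsilon>1 where e1: "0 < \<epsilon>1" "\<And>M. M \<in> (\<lambda>S. fst (snd S)) ` K \<Longrightarrow> coercive \<epsilon>1 M"
    by (rule compact_sym_posdef_imp_coercive[of "(\<lambda>S. fst (snd S)) ` K"])
      (use K adm in \<open>auto intro!: compact_continuous_image continuous_intros\<close>)
  obtain \<epsilon>2 where e2: "0 < \<epsilon>2" "\<And>M. M \<in> (\<lambda>S. fst (snd (snd S))) ` K \<Longrightarrow> coercive \<epsilon>2 M"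
    by (rule compact_sym_posdef_imp_coercive[of "(\<lambda>S. fst (snd (snd S))) ` K"])
      (use K adm in \<open>auto intro!: compact_continuous_image continuous_intros\<close>)
  obtain \<epsilon>3 where e3: "0 < \<epsilon>3" "\<And>M. M \<in> (\<lambda>S. snd (snd (snd S))) ` K \<Longrightarrow> coercive \<epsilon>3 M"
    by (rule compact_sym_posdef_imp_coercive[of "(\<lambda>S. snd (snd (snd S))) ` K"])
      (use K adm in \<open>auto intro!: compact_continuous_image continuous_intros\<close>)
  obtain \<rho> where rho: "0 < \<rho>" "\<And>S. S \<in> K \<Longrightarrow> norm S \<le> \<rho>"
    using compact_imp_bounded[OF K] unfolding bounded_pos by blast
  define \<epsilon> where "\<epsilon> = min \<epsilon>1 (min \<epsilon>2 \<epsilon>3)"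
  have "uniformly_admissible \<epsilon> \<rho> S" if "S \<in> K" for S
  proof -
    obtain A \<Gamma> R Q where S: "S = (A, \<Gamma>, R, Q)" by (metis prod_cases4)
    have "coercive \<epsilon>1 \<Gamma>" by (rule e1(2)) (use that S in force)
    moreover have "coercive \<epsilon>2 R" by (rule e2(2)) (use that S in force)
    moreover have "coercive \<epsilon>3 Q" by (rule e3(2)) (use that S in force)
    ultimately show ?thesis
      using rho(2)[OF that] unfolding S uniformly_admissible.simps
      by (auto simp: \<epsilon>_def intro: coercive_mono)
  qed
  then show thesis using that[of \<epsilon> \<rho>] e1 e2 e3 rho by (simp add: \<epsilon>_def)
qed

lemma uniformly_admissible_norms:
  assumes "uniformly_admissible \<epsilon> \<rho> (A, \<Gamma>, R, Q)"
  shows "norm A \<le> \<rho>" "norm \<Gamma> \<le> \<rho>" "norm R \<le> \<rho>" "norm Q \<le> \<rho>"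
  using assms norm_fst_le[of A "(\<Gamma>, R, Q)"] norm_snd_le[of "(\<Gamma>, R, Q)" A]
    norm_fst_le[of \<Gamma> "(R, Q)"] norm_snd_le[of "(R, Q)" \<Gamma>]
    norm_fst_le[of R Q] norm_snd_le[of Q R]
  by simp_all

section \<open>The Riccati vector field\<close>

text \<open>The matrix \<open>\<Pi> C\<^sup>T Q\<^sup>-\<^sup>1\<close> that multiplies the innovation \<open>y - C x\<close> in the observer equation.\<close>

fun kalman_gain :: "real^'n^'r \<Rightarrow> ('n::finite, 'm::finite, 'r::finite) params \<Rightarrow> real^'n^'n \<Rightarrow> real^'r^'n" where
  "kalman_gain C (A, \<Gamma>, R, Q) X = X ** transpose C ** matrix_inv Q"

fun riccati_field ::
  "real^'m^'n \<Rightarrow> real^'n^'r \<Rightarrow> ('n::finite, 'm::finite, 'r::finite) params \<Rightarrow> real^'n^'n \<Rightarrow> real^'n^'n" where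
  "riccati_field B C (A, \<Gamma>, R, Q) X =
     A ** X + X ** transpose A - X ** transpose C ** matrix_inv Q ** C ** X + B ** R ** transpose B"

lemma riccati_solution_field:
  assumes "riccati_solution T B C S X"
  shows "X 0 = fst (snd S)"
    and "t \<in> {0..T} \<Longrightarrow> (X has_vector_derivative riccati_field B C S (X t)) (at t within {0..T})"
  using assms by (cases S rule: prod_cases4; simp)+

lemma bounded_lipschitz_on_riccati_data:
  fixes B :: "real^'m^'n" and C :: "real^'n^'r"
  defines "D \<equiv> \<lambda>\<epsilon> \<rho> r. {S :: ('n, 'm, 'r) params. uniformly_admissible \<epsilon> \<rho> S} \<times> cball (0 :: real^'n^'n) r"
  assumes "0 < \<epsilon>"
  shows bounded_lipschitz_on_kalman_gain:
      "bounded_lipschitz_on (D \<epsilon> \<rho> r) (\<lambda>p. kalman_gain C (fst p) (snd p))"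
    and bounded_lipschitz_on_observer_drift:
      "bounded_lipschitz_on (D \<epsilon> \<rho> r) (\<lambda>p. fst (fst p) - kalman_gain C (fst p) (snd p) ** C)"
    and bounded_lipschitz_on_riccati_field:
      "bounded_lipschitz_on (D \<epsilon> \<rho> r) (\<lambda>p. riccati_field B C (fst p) (snd p))"
proof -
  have "{S :: ('n, 'm, 'r) params. uniformly_admissible \<epsilon> \<rho> S} \<subseteq> cball 0 \<rho>" by auto
  then have "bounded (D \<epsilon> \<rho> r)"
    unfolding D_def by (intro bounded_Times bounded_cball) (rule bounded_subset[OF bounded_cball])
  then have id: "bounded_lipschitz_on (D \<epsilon> \<rho> r) (\<lambda>p. p)" by (rule bounded_lipschitz_on_ident)
  note linear = bounded_lipschitz_on_linear[OF _ id] bounded_linear_fst_comp bounded_linear_snd_comp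
    bounded_linear_ident bounded_linear_compose[OF bounded_linear_transpose]
  have A: "bounded_lipschitz_on (D \<epsilon> \<rho> r) (\<lambda>p. fst (fst p))"
    by (rule linear(1)) (intro linear)
  have R: "bounded_lipschitz_on (D \<epsilon> \<rho> r) (\<lambda>p. fst (snd (snd (fst p))))"
    by (rule linear(1)) (intro linear)
  have Q: "bounded_lipschitz_on (D \<epsilon> \<rho> r) (\<lambda>p. snd (snd (snd (fst p))))"
    by (rule linear(1)) (intro linear)
  have X: "bounded_lipschitz_on (D \<epsilon> \<rho> r) (\<lambda>p. snd p)"
    by (rule linear(1)) (intro linear)
  have Qinv: "bounded_lipschitz_on (D \<epsilon> \<rho> r) (\<lambda>p. matrix_inv (snd (snd (snd (fst p)))))"
    by (rule bounded_lipschitz_on_matrix_inv[OF Q _ assms(2)]) (auto simp: D_def)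
  note rules = bounded_lipschitz_on_mult_matrix bounded_lipschitz_on_add bounded_lipschitz_on_diff
    bounded_lipschitz_on_transpose bounded_lipschitz_on_const A R X Qinv
  have gain_eq: "kalman_gain C S X = X ** transpose C ** matrix_inv (snd (snd (snd S)))"
    for S :: "('n, 'm, 'r) params" and X
    by (cases S rule: prod_cases4) simp
  have field_eq: "riccati_field B C S X = fst S ** X + X ** transpose (fst S)
      - X ** transpose C ** matrix_inv (snd (snd (snd S))) ** C ** X
      + B ** fst (snd (snd S)) ** transpose B"
    for S :: "('n, 'm, 'r) params" and X
    by (cases S rule: prod_cases4) simp
  show "bounded_lipschitz_on (D \<epsilon> \<rho> r) (\<lambda>p. kalman_gain C (fst p) (snd p))"
    unfolding gain_eq by (intro rules)
  show "bounded_lipschitz_on (D \<epsilon> \<rho> r) (\<lambda>p. fst (fst p) - kalman_gain C (fst p) (snd p) ** C)"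
    unfolding gain_eq by (intro rules)
  show "bounded_lipschitz_on (D \<epsilon> \<rho> r) (\<lambda>p. riccati_field B C (fst p) (snd p))"
    unfolding field_eq by (intro rules)
qed

section \<open>Riccati solutions\<close>

text \<open>Two solutions of ordinary differential equations whose right-hand sides differ by a Lipschitz term
plus a constant defect \<open>c\<close>.\<close>

lemma gronwall_vector_derivative_diff:
  fixes X Y X' Y' :: "real \<Rightarrow> 'a::euclidean_space"
  assumes X: "\<And>t. t \<in> {0..T} \<Longrightarrow> (X has_vector_derivative X' t) (at t within {0..T})"
    and Y: "\<And>t. t \<in> {0..T} \<Longrightarrow> (Y has_vector_derivative Y' t) (at t within {0..T})"
    and bound: "\<And>t. t \<in> {0..T} \<Longrightarrow> norm (X' t - Y' t) \<le> b * norm (X t - Y t) + c"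
    and "0 \<le> b" "0 \<le> c" and t: "t \<in> {0..T}"
  shows "norm (X t - Y t) \<le> (norm (X 0 - Y 0) + c * T) * exp (b * T)"
proof -
  have der: "((\<lambda>s. X s - Y s) has_vector_derivative X' s - Y' s) (at s within {0..T})"
    if "s \<in> {0..T}" for s
    using X[OF that] Y[OF that] by (rule has_vector_derivative_diff)
  have ftc: "((\<lambda>s. X' s - Y' s) has_integral (X r - Y r) - (X 0 - Y 0)) {0..r}" if "r \<in> {0..T}" for r
    by (rule fundamental_theorem_of_calculus)
      (use that in \<open>auto intro!: has_vector_derivative_within_subset[OF der]\<close>)
  have "norm (X t - Y t) \<le> (norm (X 0 - Y 0) + integral {0..T} (\<lambda>s. c)) * exp (b * T)"
  proof (rule gronwall_absolutely_continuous[where v = "\<lambda>s. X' s - Y' s" and N = "{}"])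
    show "(\<lambda>s. X' s - Y' s) integrable_on {0..T}"
      using ftc[of T] t by (auto intro: has_integral_integrable)
    show "X s - Y s = (X 0 - Y 0) + integral {0..s} (\<lambda>s. X' s - Y' s)" if "s \<in> {0..T}" for s
      using integral_unique[OF ftc[OF that]] by simp
  qed (use assms in auto)
  then show ?thesis using t by (simp add: mult.commute)
qed

lemma transpose_riccati_field:
  fixes B :: "real^'m^'n" and C :: "real^'n^'r"
  assumes "0 < \<epsilon>" "uniformly_admissible \<epsilon> \<rho> S"
  shows "transpose (riccati_field B C S X) = riccati_field B C S (transpose X)"
proof -
  obtain A \<Gamma> R Q where S: "S = (A, \<Gamma>, R, Q)" by (metis prod_cases4)
  have "transpose (matrix_inv Q) = matrix_inv Q" "transpose R = R"
    using assms transpose_matrix_inv_coercive by (auto simp: S coercive_def)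
  moreover have "transpose (Y + Z) = transpose Y + transpose Z"
    "transpose (Y - Z) = transpose Y - transpose Z" for Y Z :: "real^'n^'n"
    by (simp_all add: linear_add linear_diff bounded_linear.linear[OF bounded_linear_transpose])
  ultimately show ?thesis
    by (simp add: S matrix_transpose_mul matrix_mul_assoc add.commute)
qed

lemma continuous_image_norm_bound:
  assumes "continuous_on {0..T::real} X"
  obtains r where "\<And>t. t \<in> {0..T} \<Longrightarrow> norm (X t) \<le> r"
proof -
  from compact_imp_bounded[OF compact_continuous_image[OF assms]]
  obtain r where "\<forall>x\<in>X ` {0..T}. norm x \<le> r" unfolding bounded_iff by auto
  then show thesis by (intro that[of r]) auto
qed

text \<open>The transpose of a solution solves the same Riccati equation with the same symmetric initial value.
The field is Lipschitz on the ball that contains both, so Gronwall's inequality shows that they agree.\<close>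

lemma riccati_solution_symmetric:
  assumes "0 < \<epsilon>" and S: "uniformly_admissible \<epsilon> \<rho> S" and sol: "riccati_solution T B C S X"
    and t: "t \<in> {0..T}"
  shows "transpose (X t) = X t"
proof -
  note X' = riccati_solution_field(2)[OF sol]
  have "continuous_on {0..T} X" by (rule continuous_on_vector_derivative[OF X'])
  then have "continuous_on {0..T} (\<lambda>t. (X t, transpose (X t)))"
    by (intro continuous_intros bounded_linear.continuous_on[OF bounded_linear_transpose])
  then obtain r where r: "\<And>t. t \<in> {0..T} \<Longrightarrow> norm (X t, transpose (X t)) \<le> r"
    by (rule continuous_image_norm_bound) blast
  have rX: "norm (X t) \<le> r" "norm (transpose (X t)) \<le> r" if "t \<in> {0..T}" for t
    using r[OF that] norm_fst_le[of "X t" "transpose (X t)"] norm_snd_le[of "transpose (X t)" "X t"]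
    by simp_all
  obtain L where L: "0 \<le> L"
    "\<And>S S' Y Y'. S \<in> {S. uniformly_admissible \<epsilon> \<rho> S} \<Longrightarrow> S' \<in> {S. uniformly_admissible \<epsilon> \<rho> S} \<Longrightarrow>
      Y \<in> cball 0 r \<Longrightarrow> Y' \<in> cball 0 r \<Longrightarrow>
      norm (riccati_field B C S Y - riccati_field B C S' Y') \<le> L * (dist S S' + dist Y Y')"
    by (rule bounded_lipschitz_on_prodE[OF bounded_lipschitz_on_riccati_field[OF assms(1), of \<rho> r B C]])
      (rule that, assumption, blast)
  have "norm (X t - transpose (X t)) \<le> (norm (X 0 - transpose (X 0)) + 0 * T) * exp (L * T)"
  proof (rule gronwall_vector_derivative_diff[OF X' _ _ _ _ t])
    show "((\<lambda>t. transpose (X t)) has_vector_derivative transpose (riccati_field B C S (X s)))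
        (at s within {0..T})" if "s \<in> {0..T}" for s
      by (rule bounded_linear.has_vector_derivative[OF bounded_linear_transpose X'[OF that]])
    show "norm (riccati_field B C S (X s) - transpose (riccati_field B C S (X s)))
        \<le> L * norm (X s - transpose (X s)) + 0" if "s \<in> {0..T}" for s
      using L(2)[of S S "X s" "transpose (X s)"] rX[OF that] S
      by (simp add: transpose_riccati_field[OF assms(1,2)] dist_norm)
  qed (use L in auto)
  moreover have "transpose (X 0) = X 0"
    using S riccati_solution_field(1)[OF sol] by (cases S rule: prod_cases4) (simp add: coercive_def)
  ultimately show ?thesis by simp
qed

text \<open>On an eigenvector both the linear and the quadratic term of the Riccati field become scalar multiples of
forms in the data \<open>A\<close>, \<open>C\<^sup>T Q\<^sup>-\<^sup>1 C\<close> and \<open>B R B\<^sup>T\<close>. The matrix \<open>X\<close> itself enters only through its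
eigenvalue \<open>l\<close>.\<close>

lemma riccati_field_at_eigenvector:
  fixes \<xi> :: "real^'n"
  assumes sym: "transpose X = X" and eig: "X *v \<xi> = l *\<^sub>R \<xi>"
  shows "\<xi> \<bullet> (riccati_field B C (A, \<Gamma>, R, Q) X *v \<xi>) =
    2 * l * (\<xi> \<bullet> (A *v \<xi>)) - l\<^sup>2 * ((C *v \<xi>) \<bullet> (matrix_inv Q *v (C *v \<xi>)))
    + (transpose B *v \<xi>) \<bullet> (R *v (transpose B *v \<xi>))"
proof -
  have left: "\<xi> \<bullet> (X *v z) = l * (\<xi> \<bullet> z)" for z
    using inner_symmetric_matrix[OF sym, of \<xi> z] by (simp add: eig)
  have "\<xi> \<bullet> (A ** X *v \<xi>) = l * (\<xi> \<bullet> (A *v \<xi>))"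
    by (simp add: eig matrix_vector_mult_scaleR flip: matrix_vector_mul_assoc)
  moreover have "\<xi> \<bullet> (X ** transpose A *v \<xi>) = l * (\<xi> \<bullet> (A *v \<xi>))"
    using inner_transpose_matrix[of \<xi> A \<xi>]
    by (simp add: left inner_commute flip: matrix_vector_mul_assoc)
  moreover have "\<xi> \<bullet> (X ** transpose C ** matrix_inv Q ** C ** X *v \<xi>)
      = l\<^sup>2 * ((C *v \<xi>) \<bullet> (matrix_inv Q *v (C *v \<xi>)))"
    using inner_transpose_matrix[of \<xi> C "matrix_inv Q *v (C *v \<xi>)"]
    by (simp add: left eig matrix_vector_mult_scaleR power2_eq_square flip: matrix_vector_mul_assoc)
  moreover have "\<xi> \<bullet> (B ** R ** transpose B *v \<xi>)
      = (transpose B *v \<xi>) \<bullet> (R *v (transpose B *v \<xi>))"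
    using inner_transpose_matrix[of \<xi> "transpose B" "R *v (transpose B *v \<xi>)"]
    by (simp flip: matrix_vector_mul_assoc)
  ultimately show ?thesis
    by (simp add: matrix_vector_mult_add_rdistrib matrix_vector_mult_diff_rdistrib
        inner_add_right inner_diff_right)
qed

text \<open>Exponential barriers \<open>\<epsilon>/2 \<cdot> exp (- L t)\<close> from below and \<open>(\<rho> + 1) \<cdot> exp (M t)\<close> from above confine the
spectrum of \<open>\<Pi>\<close>. The linear term of the equation contributes at most \<open>2 \<rho> l\<close> on either side.
At the lower barrier the eigenvalue \<open>l\<close> is at most \<open>\<epsilon>/2\<close>, so the quadratic damping, bounded by
\<open>l\<^sup>2 \<mu>\<close>, is at most \<open>l \<cdot> \<epsilon>/2 \<cdot> \<mu>\<close> and is beaten by the decay rate \<open>L\<close>. At the upper barrier the damping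
has the favourable sign, and since \<open>l \<ge> 1\<close> the forcing \<open>\<nu>\<close> is at most \<open>l \<nu>\<close> and is beaten by the growth
rate \<open>M\<close>. The upper bound is obtained by applying the barrier lemma to \<open>- \<Pi>\<close>.\<close>

lemma riccati_solution_uniform_bounds:
  fixes B :: "real^'m^'n" and C :: "real^'n^'r"
  assumes \<epsilon>: "0 < \<epsilon>" and \<rho>: "0 < \<rho>" and "0 \<le> T"
  obtains \<alpha> \<beta> where "0 < \<alpha>" "0 < \<beta>"
    "\<And>S X t. uniformly_admissible \<epsilon> \<rho> S \<Longrightarrow> riccati_solution T B C S X \<Longrightarrow> t \<in> {0..T} \<Longrightarrow>
       coercive \<alpha> (X t) \<and> (\<forall>x. norm (X t *v x) \<le> \<beta> * norm x)"
proof -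
  \<comment> \<open>bounds of the forms of \<open>C\<^sup>T Q\<^sup>-\<^sup>1 C\<close> and \<open>B R B\<^sup>T\<close> on the unit sphere\<close>
  define \<mu> where "\<mu> = (1 / \<epsilon>) * (norm C)\<^sup>2"
  define \<nu> where "\<nu> = \<rho> * (norm (transpose B))\<^sup>2"
  define L where "L = 2 * \<rho> + \<epsilon> / 2 * \<mu> + 1"
  define M where "M = 2 * \<rho> + \<nu> + 1"
  define \<alpha> where "\<alpha> = \<epsilon> / 2 * exp (- (L * T))"
  define \<beta> where "\<beta> = (\<rho> + 1) * exp (M * T)"
  have "0 \<le> \<mu>" "0 \<le> \<nu>" "0 < L" "0 < M" "0 < \<alpha>" "0 < \<beta>"
    using \<epsilon> \<rho> by (auto simp: \<mu>_def \<nu>_def L_def M_def \<alpha>_def \<beta>_def intro!: add_nonneg_pos)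
  have "coercive \<alpha> (X t) \<and> (\<forall>x. norm (X t *v x) \<le> \<beta> * norm x)"
    if S: "uniformly_admissible \<epsilon> \<rho> S" and sol: "riccati_solution T B C S X" and t: "t \<in> {0..T}" for S X t
  proof -
    obtain A \<Gamma> R Q where Seq: "S = (A, \<Gamma>, R, Q)" by (metis prod_cases4)
    note X' = riccati_solution_field(2)[OF sol]
    note sym = riccati_solution_symmetric[OF \<epsilon> S sol]
    have X0: "X 0 = \<Gamma>" using riccati_solution_field(1)[OF sol] by (simp add: Seq)
    have co: "coercive \<epsilon> \<Gamma>" "coercive \<epsilon> R" "coercive \<epsilon> Q" using S by (auto simp: Seq)
    note nrm = uniformly_admissible_norms[OF S[unfolded Seq]]
    have aA: "\<bar>\<xi> \<bullet> (A *v \<xi>)\<bar> \<le> \<rho>" if "norm \<xi> = 1" for \<xi>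
      using quadratic_form_le_norm[of \<xi> A] nrm(1) that by simp
    have qQ: "0 \<le> (C *v \<xi>) \<bullet> (matrix_inv Q *v (C *v \<xi>))"
      "(C *v \<xi>) \<bullet> (matrix_inv Q *v (C *v \<xi>)) \<le> \<mu>" if "norm \<xi> = 1" for \<xi>
    proof -
      show "0 \<le> (C *v \<xi>) \<bullet> (matrix_inv Q *v (C *v \<xi>))"
        by (rule matrix_inv_quadratic_form_nonneg[OF co(3) \<epsilon>])
      have "(C *v \<xi>) \<bullet> (matrix_inv Q *v (C *v \<xi>)) \<le> (1 / \<epsilon>) * (norm (C *v \<xi>))\<^sup>2"
        by (rule matrix_inv_quadratic_form_le[OF co(3) \<epsilon>])
      also have "\<dots> \<le> \<mu>"
        unfolding \<mu>_def using norm_matrix_vector_mult_le[of C \<xi>] that \<epsilon>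
        by (intro mult_left_mono power_mono) auto
      finally show "(C *v \<xi>) \<bullet> (matrix_inv Q *v (C *v \<xi>)) \<le> \<mu>" .
    qed
    have rR: "0 \<le> (transpose B *v \<xi>) \<bullet> (R *v (transpose B *v \<xi>))"
      "(transpose B *v \<xi>) \<bullet> (R *v (transpose B *v \<xi>)) \<le> \<nu>" if "norm \<xi> = 1" for \<xi>
    proof -
      let ?z = "transpose B *v \<xi>"
      have "0 \<le> \<epsilon> * (norm ?z)\<^sup>2" using \<epsilon> by simp
      also have "\<dots> \<le> ?z \<bullet> (R *v ?z)" using co(2) unfolding coercive_def by blast
      finally show "0 \<le> ?z \<bullet> (R *v ?z)" .
      have "?z \<bullet> (R *v ?z) \<le> norm R * (norm ?z)\<^sup>2"
        using quadratic_form_le_norm[of ?z R] by linarith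
      also have "\<dots> \<le> \<nu>"
        unfolding \<nu>_def using norm_matrix_vector_mult_le[of "transpose B" \<xi>] that nrm(3) \<rho>
        by (intro mult_mono power_mono) auto
      finally show "?z \<bullet> (R *v ?z) \<le> \<nu>" .
    qed
    have lower: "\<epsilon> / 2 * exp (- (L * t)) < \<xi> \<bullet> (X t *v \<xi>)" if "norm \<xi> = 1" for \<xi>
    proof (rule symmetric_matrix_barrier[where \<phi> = "\<lambda>t. \<epsilon> / 2 * exp (- (L * t))" and
          \<phi>' = "\<lambda>t. - L * (\<epsilon> / 2 * exp (- (L * t)))", OF X' sym _ _ _ t that])
      fix s \<zeta> assume s: "s \<in> {0..T}" and \<zeta>: "norm \<zeta> = 1"
        and eig: "X s *v \<zeta> = (\<epsilon> / 2 * exp (- (L * s))) *\<^sub>R \<zeta>"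
      define l where "l = \<epsilon> / 2 * exp (- (L * s))"
      have l: "0 < l" "l \<le> \<epsilon> / 2" using \<epsilon> \<open>0 < L\<close> s by (auto simp: l_def)
      have "l * ((C *v \<zeta>) \<bullet> (matrix_inv Q *v (C *v \<zeta>))) \<le> \<epsilon> / 2 * \<mu>"
        by (intro mult_mono l qQ[OF \<zeta>]) (use \<epsilon> \<open>0 \<le> \<mu>\<close> in auto)
      then have "0 < L + 2 * (\<zeta> \<bullet> (A *v \<zeta>)) - l * ((C *v \<zeta>) \<bullet> (matrix_inv Q *v (C *v \<zeta>)))"
        using aA[OF \<zeta>] unfolding L_def by linarith
      from mult_pos_pos[OF l(1) this]
      have "- L * l < 2 * l * (\<zeta> \<bullet> (A *v \<zeta>)) - l\<^sup>2 * ((C *v \<zeta>) \<bullet> (matrix_inv Q *v (C *v \<zeta>)))"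
        by (simp add: algebra_simps power2_eq_square)
      then show "- L * (\<epsilon> / 2 * exp (- (L * s))) < \<zeta> \<bullet> (riccati_field B C S (X s) *v \<zeta>)"
        unfolding Seq riccati_field_at_eigenvector[OF sym[OF s] eig] l_def[symmetric]
        using rR(1)[OF \<zeta>] by linarith
    next
      fix \<zeta> :: "real^'n" assume "norm \<zeta> = 1"
      then have "\<epsilon> \<le> \<zeta> \<bullet> (X 0 *v \<zeta>)" using co(1) by (auto simp: X0 coercive_def dest: spec[of _ \<zeta>])
      then show "\<epsilon> / 2 * exp (- (L * 0)) < \<zeta> \<bullet> (X 0 *v \<zeta>)" using \<epsilon> by simp
    qed (auto intro!: derivative_eq_intros)
    have upper: "- ((\<rho> + 1) * exp (M * t)) < \<xi> \<bullet> (- X t *v \<xi>)" if "norm \<xi> = 1" for \<xi>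
    proof (rule symmetric_matrix_barrier[where \<phi> = "\<lambda>t. - ((\<rho> + 1) * exp (M * t))" and
          \<phi>' = "\<lambda>t. - (M * ((\<rho> + 1) * exp (M * t)))" and X = "\<lambda>t. - X t", OF _ _ _ _ _ t that])
      show "((\<lambda>t. - X t) has_vector_derivative - riccati_field B C S (X s)) (at s within {0..T})"
        if "s \<in> {0..T}" for s
        by (rule has_vector_derivative_minus[OF X'[OF that]])
      show "transpose (- X s) = - X s" if "s \<in> {0..T}" for s
        using sym[OF that] linear_neg[OF bounded_linear.linear[OF bounded_linear_transpose], of "X s"]
        by simp
      fix s \<zeta> assume s: "s \<in> {0..T}" and \<zeta>: "norm \<zeta> = 1"
        and "- X s *v \<zeta> = (- ((\<rho> + 1) * exp (M * s))) *\<^sub>R \<zeta>"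
      then have eig: "X s *v \<zeta> = ((\<rho> + 1) * exp (M * s)) *\<^sub>R \<zeta>"
        by (simp add: bounded_bilinear.minus_left[OF bounded_bilinear_matrix_vector_mult])
      define l where "l = (\<rho> + 1) * exp (M * s)"
      have "1 * 1 \<le> l" unfolding l_def using \<rho> \<open>0 < M\<close> s by (intro mult_mono) auto
      then have l: "1 \<le> l" by simp
      have "2 * l * (\<zeta> \<bullet> (A *v \<zeta>)) \<le> 2 * l * \<rho>"
        using aA[OF \<zeta>] l by (intro mult_left_mono) auto
      moreover have "\<nu> \<le> l * \<nu>" using l \<open>0 \<le> \<nu>\<close> mult_right_mono[of 1 l \<nu>] by simp
      moreover have "0 \<le> l\<^sup>2 * ((C *v \<zeta>) \<bullet> (matrix_inv Q *v (C *v \<zeta>)))"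
        using qQ(1)[OF \<zeta>] by simp
      moreover have "M * l = 2 * l * \<rho> + l * \<nu> + l" by (simp add: M_def algebra_simps)
      ultimately have "\<zeta> \<bullet> (riccati_field B C S (X s) *v \<zeta>) < M * l"
        unfolding Seq riccati_field_at_eigenvector[OF sym[OF s] eig] l_def[symmetric]
        using rR(2)[OF \<zeta>] l by linarith
      then show "- (M * ((\<rho> + 1) * exp (M * s))) < \<zeta> \<bullet> (- riccati_field B C S (X s) *v \<zeta>)"
        by (simp add: l_def bounded_bilinear.minus_left[OF bounded_bilinear_matrix_vector_mult])
    next
      fix \<zeta> :: "real^'n" assume "norm \<zeta> = 1"
      then have "\<zeta> \<bullet> (X 0 *v \<zeta>) \<le> \<rho>"
        using quadratic_form_le_norm[of \<zeta> \<Gamma>] nrm(2) by (simp add: X0)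
      then show "- ((\<rho> + 1) * exp (M * 0)) < \<zeta> \<bullet> (- X 0 *v \<zeta>)"
        by (simp add: bounded_bilinear.minus_left[OF bounded_bilinear_matrix_vector_mult])
    qed (auto intro!: derivative_eq_intros)
    have "\<alpha> \<le> \<epsilon> / 2 * exp (- (L * t))"
      unfolding \<alpha>_def using t \<epsilon> \<open>0 < L\<close> by (intro mult_left_mono) auto
    then have \<alpha>: "\<alpha> * (norm x)\<^sup>2 \<le> x \<bullet> (X t *v x)" for x
      by (intro quadratic_form_ge_of_sphere) (use lower in \<open>force intro: less_imp_le\<close>)
    have "- \<beta> \<le> - ((\<rho> + 1) * exp (M * t))"
      unfolding \<beta>_def using t \<rho> \<open>0 < M\<close> by (simp add: mult_left_mono)
    then have "- \<beta> * (norm x)\<^sup>2 \<le> x \<bullet> (- X t *v x)" for x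
      by (intro quadratic_form_ge_of_sphere) (use upper in \<open>force intro: less_imp_le\<close>)
    then have \<beta>: "x \<bullet> (X t *v x) \<le> \<beta> * (norm x)\<^sup>2" for x
      by (simp add: bounded_bilinear.minus_left[OF bounded_bilinear_matrix_vector_mult])
    have "\<bar>x \<bullet> (X t *v x)\<bar> \<le> \<beta> * (norm x)\<^sup>2" for x
    proof -
      have "0 \<le> \<alpha> * (norm x)\<^sup>2" using \<open>0 < \<alpha>\<close> by simp
      with \<alpha>[of x] \<beta>[of x] show ?thesis by linarith
    qed
    then have "norm (X t *v x) \<le> \<beta> * norm x" for x
      by (rule symmetric_matrix_operator_bound[OF sym[OF t]])
    with \<alpha> sym[OF t] show ?thesis by (simp add: coercive_def)
  qed
  with \<open>0 < \<alpha>\<close> \<open>0 < \<beta>\<close> show thesis by (rule that)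
qed

section \<open>Dependence of Riccati and observer trajectories on the parameters\<close>

lemma riccati_solution_norm_bound:
  fixes B :: "real^'m^'n" and C :: "real^'n^'r"
  assumes \<epsilon>: "0 < \<epsilon>" and "0 < \<rho>" "0 \<le> T"
  obtains r where
    "\<And>S X t. uniformly_admissible \<epsilon> \<rho> S \<Longrightarrow> riccati_solution T B C S X \<Longrightarrow> t \<in> {0..T} \<Longrightarrow>
       X t \<in> cball 0 r"
proof -
  obtain \<alpha> \<beta> where "0 < \<alpha>" "0 < \<beta>" and b:
    "\<And>S X t. uniformly_admissible \<epsilon> \<rho> S \<Longrightarrow> riccati_solution T B C S X \<Longrightarrow> t \<in> {0..T} \<Longrightarrow>
       coercive \<alpha> (X t) \<and> (\<forall>x. norm (X t *v x) \<le> \<beta> * norm x)"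
    by (rule riccati_solution_uniform_bounds[OF assms, of B C]) blast
  show thesis
  proof (rule that)
    fix S X t
    assume "uniformly_admissible \<epsilon> \<rho> S" "riccati_solution T B C S X" "t \<in> {0..T}"
    from b[OF this] have "norm (X t) \<le> real CARD('n) * \<beta>"
      by (intro norm_symmetric_matrix_le) (auto simp: coercive_def)
    then show "X t \<in> cball 0 (real CARD('n) * \<beta>)" by simp
  qed
qed

lemma riccati_solution_lipschitz:
  fixes B :: "real^'m^'n" and C :: "real^'n^'r"
  assumes \<epsilon>: "0 < \<epsilon>" and \<rho>: "0 < \<rho>" and T: "0 \<le> T"
  obtains l where "0 \<le> l"
    "\<And>S S' X X' t. uniformly_admissible \<epsilon> \<rho> S \<Longrightarrow> riccati_solution T B C S X \<Longrightarrow>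
       uniformly_admissible \<epsilon> \<rho> S' \<Longrightarrow> riccati_solution T B C S' X' \<Longrightarrow> t \<in> {0..T} \<Longrightarrow>
       dist (X t) (X' t) \<le> l * dist S S'"
proof -
  obtain r where r:
    "\<And>S X t. uniformly_admissible \<epsilon> \<rho> S \<Longrightarrow> riccati_solution T B C S X \<Longrightarrow> t \<in> {0..T} \<Longrightarrow>
       X t \<in> cball 0 r"
    by (rule riccati_solution_norm_bound[OF assms, of B C]) blast
  obtain L where L: "0 \<le> L"
    "\<And>S S' Y Y'. S \<in> {S. uniformly_admissible \<epsilon> \<rho> S} \<Longrightarrow> S' \<in> {S. uniformly_admissible \<epsilon> \<rho> S} \<Longrightarrow>
      Y \<in> cball 0 r \<Longrightarrow> Y' \<in> cball 0 r \<Longrightarrow>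
      norm (riccati_field B C S Y - riccati_field B C S' Y') \<le> L * (dist S S' + dist Y Y')"
    by (rule bounded_lipschitz_on_prodE[OF bounded_lipschitz_on_riccati_field[OF \<epsilon>, of \<rho> r B C]])
      (rule that, assumption, blast)
  show thesis
  proof (rule that)
    show "0 \<le> (1 + L * T) * exp (L * T)" using L(1) T by simp
    fix S S' X X' t
    assume S: "uniformly_admissible \<epsilon> \<rho> S" and X: "riccati_solution T B C S X"
      and S': "uniformly_admissible \<epsilon> \<rho> S'" and X': "riccati_solution T B C S' X'" and t: "t \<in> {0..T}"
    have "norm (X t - X' t) \<le> (norm (X 0 - X' 0) + (L * dist S S') * T) * exp (L * T)"
    proof (rule gronwall_vector_derivative_diff
        [OF riccati_solution_field(2)[OF X] riccati_solution_field(2)[OF X'] _ _ _ t])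
      fix s assume s: "s \<in> {0..T}"
      show "norm (riccati_field B C S (X s) - riccati_field B C S' (X' s))
          \<le> L * norm (X s - X' s) + L * dist S S'"
        using L(2)[of S S' "X s" "X' s"] r[OF S X s] r[OF S' X' s] S S'
        by (simp add: dist_norm algebra_simps)
    qed (use L in auto)
    also have "norm (X 0 - X' 0) \<le> dist S S'"
    proof -
      have "dist (X 0) (X' 0) \<le> dist (snd S) (snd S')"
        unfolding riccati_solution_field(1)[OF X] riccati_solution_field(1)[OF X']
        by (rule dist_fst_le)
      also have "\<dots> \<le> dist S S'" by (rule dist_snd_le)
      finally show ?thesis by (simp add: dist_norm)
    qed
    finally show "dist (X t) (X' t) \<le> ((1 + L * T) * exp (L * T)) * dist S S'"
      by (simp add: dist_norm algebra_simps)
  qed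
qed

text \<open>On a bounded interval \<open>\<parallel>f\<parallel> \<le> 1 + \<parallel>f\<parallel>\<^sup>2\<close> is an integrable bound.\<close>

lemma L2_on_imp_absolutely_integrable:
  fixes f :: "real \<Rightarrow> 'a::euclidean_space"
  assumes "L2_on T f"
  shows "f absolutely_integrable_on {0..T}"
proof -
  have m: "set_borel_measurable lebesgue {0..T} f"
    and sq: "set_integrable lebesgue {0..T} (\<lambda>t. (norm (f t))\<^sup>2)"
    using assms by (auto simp: L2_on_def)
  have "set_integrable lebesgue {0..T} (\<lambda>t. 1 :: real)"
    by (rule absolutely_integrable_continuous_real) (rule continuous_on_const)
  from set_integral_add(1)[OF this sq]
  have "set_integrable lebesgue {0..T} (\<lambda>t. 1 + (norm (f t))\<^sup>2)" .
  then show ?thesis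
    unfolding set_integrable_def
  proof (rule Bochner_Integration.integrable_bound)
    show "(\<lambda>x. indicat_real {0..T} x *\<^sub>R f x) \<in> borel_measurable lebesgue"
      using m by (simp add: set_borel_measurable_def)
    have "norm (f x) \<le> 1 + (norm (f x))\<^sup>2" for x
    proof -
      have "0 \<le> (norm (f x) - 1)\<^sup>2" by simp
      then have "2 * norm (f x) \<le> 1 + (norm (f x))\<^sup>2" by (simp add: power2_diff)
      then show ?thesis using norm_ge_zero[of "f x"] by linarith
    qed
    then show "AE x in lebesgue. norm (indicat_real {0..T} x *\<^sub>R f x)
        \<le> norm (indicat_real {0..T} x *\<^sub>R (1 + (norm (f x))\<^sup>2))"
      by (intro AE_I2) (auto simp: indicator_def intro: order_trans[OF _ abs_ge_self])
  qed
qed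

text \<open>The observer equation in closed-loop form \<open>x' = (A - G C) x + G y\<close> with gain \<open>G\<close>, which separates the
bounded drift from the forcing by the output.\<close>

lemma observer_solution_integral_form:
  fixes S :: "('n::finite, 'm::finite, 'r::finite) params"
  assumes "observer_solution T C x0 y S X xh"
  obtains v N where "xh 0 = x0" "v integrable_on {0..T}"
    "\<And>t. t \<in> {0..T} \<Longrightarrow> xh t = xh 0 + integral {0..t} v" "negligible N"
    "\<And>s. s \<in> {0..T} - N \<Longrightarrow>
       v s = (fst S - kalman_gain C S (X s) ** C) *v xh s + kalman_gain C S (X s) *v y s"
proof -
  obtain A \<Gamma> R Q where S: "S = (A, \<Gamma>, R, Q)" by (metis prod_cases4)
  obtain v where "xh 0 = x0" and v: "H1_deriv T xh v"
    and ae: "AE t in lebesgue. t \<in> {0..T} \<longrightarrow>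
           v t = A *v xh t + (X t ** transpose C ** matrix_inv Q) *v (y t - C *v xh t)"
    using assms by (auto simp: S)
  have abs: "v absolutely_integrable_on {0..T}"
    using v L2_on_imp_absolutely_integrable by (auto simp: H1_deriv_def)
  have int: "xh t = xh 0 + integral {0..t} v" if "t \<in> {0..T}" for t
  proof -
    have "v absolutely_integrable_on {0..t}"
      by (rule set_integrable_subset[OF abs]) (use that in auto)
    moreover have "xh t = xh 0 + (LINT s:{0..t}|lebesgue. v s)"
      using v that unfolding H1_deriv_def by blast
    ultimately show ?thesis by (simp only: set_lebesgue_integral_eq_integral(2))
  qed
  from ae obtain N where N: "negligible N" and sub: "{t. \<not> (t \<in> {0..T} \<longrightarrow>
      v t = A *v xh t + (X t ** transpose C ** matrix_inv Q) *v (y t - C *v xh t))} \<subseteq> N"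
    unfolding eventually_ae_filter_negligible by blast
  show thesis
  proof (rule that[OF \<open>xh 0 = x0\<close> _ int N])
    show "v integrable_on {0..T}" by (rule set_lebesgue_integral_eq_integral(1)[OF abs])
    fix s assume s: "s \<in> {0..T} - N"
    with sub have "v s = A *v xh s + (X s ** transpose C ** matrix_inv Q) *v (y s - C *v xh s)"
      by blast
    then show "v s = (fst S - kalman_gain C S (X s) ** C) *v xh s + kalman_gain C S (X s) *v y s"
      by (simp add: S matrix_vector_mult_diff_rdistrib matrix_vector_mult_diff_distrib
          flip: matrix_vector_mul_assoc)
  qed
qed

lemma observer_solution_norm_bound:
  fixes B :: "real^'m^'n" and C :: "real^'n^'r" and y :: "real \<Rightarrow> real^'r"
  assumes \<epsilon>: "0 < \<epsilon>" and \<rho>: "0 < \<rho>" and T: "0 \<le> T" and y: "L2_on T y"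
  obtains M where "0 \<le> M"
    "\<And>S X xh t. uniformly_admissible \<epsilon> \<rho> S \<Longrightarrow> riccati_solution T B C S X \<Longrightarrow>
       observer_solution T C x0 y S X xh \<Longrightarrow> t \<in> {0..T} \<Longrightarrow> norm (xh t) \<le> M"
proof -
  obtain r where r:
    "\<And>S X t. uniformly_admissible \<epsilon> \<rho> S \<Longrightarrow> riccati_solution T B C S X \<Longrightarrow> t \<in> {0..T} \<Longrightarrow>
       X t \<in> cball 0 r"
    by (rule riccati_solution_norm_bound[OF \<epsilon> \<rho> T, of B C]) blast
  obtain g where g: "0 \<le> g" "\<And>(S :: ('n, 'm, 'r) params) Y. S \<in> {S. uniformly_admissible \<epsilon> \<rho> S} \<Longrightarrow>
      Y \<in> cball 0 r \<Longrightarrow> norm (kalman_gain C S Y) \<le> g"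
    by (rule bounded_lipschitz_on_prodE[OF bounded_lipschitz_on_kalman_gain[OF \<epsilon>, of \<rho> r C]])
      (rule that, assumption, blast)
  obtain d where d: "0 \<le> d" "\<And>(S :: ('n, 'm, 'r) params) Y. S \<in> {S. uniformly_admissible \<epsilon> \<rho> S} \<Longrightarrow>
      Y \<in> cball 0 r \<Longrightarrow> norm (fst S - kalman_gain C S Y ** C) \<le> d"
    by (rule bounded_lipschitz_on_prodE[OF bounded_lipschitz_on_observer_drift[OF \<epsilon>, of \<rho> r C]])
      (rule that, assumption, blast)
  have yint: "(\<lambda>s. g * norm (y s)) integrable_on {0..T}"
    using L2_on_imp_absolutely_integrable[OF y]
    by (intro integrable_on_mult_right) (simp add: absolutely_integrable_on_def)
  define M where "M = (norm x0 + integral {0..T} (\<lambda>s. g * norm (y s))) * exp (d * T)"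
  have bound: "norm (xh t) \<le> M"
    if S: "uniformly_admissible \<epsilon> \<rho> S" and X: "riccati_solution T B C S X"
      and xh: "observer_solution T C x0 y S X xh" and t: "t \<in> {0..T}" for S X xh t
  proof -
    obtain v N where v: "xh 0 = x0" "v integrable_on {0..T}"
      "\<And>t. t \<in> {0..T} \<Longrightarrow> xh t = xh 0 + integral {0..t} v" "negligible N"
      "\<And>s. s \<in> {0..T} - N \<Longrightarrow>
       v s = (fst S - kalman_gain C S (X s) ** C) *v xh s + kalman_gain C S (X s) *v y s"
      by (rule observer_solution_integral_form[OF xh]) blast
    have "norm (xh t) \<le> (norm (xh 0) + integral {0..T} (\<lambda>s. g * norm (y s))) * exp (d * T)"
    proof (rule gronwall_absolutely_continuous[OF v(2,3,4) _ yint _ d(1) t])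
      fix s assume s: "s \<in> {0..T} - N"
      then have Xs: "X s \<in> cball 0 r" using r[OF S X] by blast
      have "norm (v s) \<le> norm (fst S - kalman_gain C S (X s) ** C) * norm (xh s)
          + norm (kalman_gain C S (X s)) * norm (y s)"
        unfolding v(5)[OF s]
        by (intro order_trans[OF norm_triangle_ineq] add_mono norm_matrix_vector_mult_le)
      also have "\<dots> \<le> d * norm (xh s) + g * norm (y s)"
        using d(2)[OF _ Xs] g(2)[OF _ Xs] S by (intro add_mono mult_right_mono) auto
      finally show "norm (v s) \<le> d * norm (xh s) + g * norm (y s)" .
    qed (use g in auto)
    then show ?thesis by (simp add: v(1) M_def)
  qed
  have "0 \<le> integral {0..T} (\<lambda>s. g * norm (y s))"
    by (rule integral_nonneg[OF yint]) (use g in auto)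
  then have "0 \<le> M" by (simp add: M_def)
  then show thesis by (rule that) (rule bound)
qed

text \<open>The difference of two observers with drifts \<open>D, D'\<close> and gains \<open>G, G'\<close> satisfies
\<open>(x - x')' = D (x - x') + (D - D') x' + (G - G') y\<close>. The last two terms are of the size of the
parameter distance, because drift and gain are Lipschitz in the parameters and the Riccati
solution, which itself is Lipschitz in the parameters; and \<open>\<parallel>y\<parallel>\<close> is integrable.\<close>

lemma observer_solution_lipschitz:
  fixes B :: "real^'m^'n" and C :: "real^'n^'r" and y :: "real \<Rightarrow> real^'r"
  assumes \<epsilon>: "0 < \<epsilon>" and \<rho>: "0 < \<rho>" and T: "0 \<le> T" and y: "L2_on T y"
  obtains l where "0 \<le> l"
    "\<And>S S' X X' xh xh' t. uniformly_admissible \<epsilon> \<rho> S \<Longrightarrow> riccati_solution T B C S X \<Longrightarrow>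
       observer_solution T C x0 y S X xh \<Longrightarrow>
       uniformly_admissible \<epsilon> \<rho> S' \<Longrightarrow> riccati_solution T B C S' X' \<Longrightarrow>
       observer_solution T C x0 y S' X' xh' \<Longrightarrow> t \<in> {0..T} \<Longrightarrow>
       norm (xh t - xh' t) \<le> l * dist S S'"
proof -
  obtain r where r:
    "\<And>S X t. uniformly_admissible \<epsilon> \<rho> S \<Longrightarrow> riccati_solution T B C S X \<Longrightarrow> t \<in> {0..T} \<Longrightarrow>
       X t \<in> cball 0 r"
    by (rule riccati_solution_norm_bound[OF \<epsilon> \<rho> T, of B C]) blast
  obtain g where g: "0 \<le> g"
    "\<And>(S :: ('n, 'm, 'r) params) S' Y Y'. S \<in> {S. uniformly_admissible \<epsilon> \<rho> S} \<Longrightarrow>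
      S' \<in> {S. uniformly_admissible \<epsilon> \<rho> S} \<Longrightarrow> Y \<in> cball 0 r \<Longrightarrow> Y' \<in> cball 0 r \<Longrightarrow>
      norm (kalman_gain C S Y - kalman_gain C S' Y') \<le> g * (dist S S' + dist Y Y')"
    by (rule bounded_lipschitz_on_prodE[OF bounded_lipschitz_on_kalman_gain[OF \<epsilon>, of \<rho> r C]])
      (rule that, assumption, blast)
  obtain d where d: "0 \<le> d"
    "\<And>(S :: ('n, 'm, 'r) params) Y. S \<in> {S. uniformly_admissible \<epsilon> \<rho> S} \<Longrightarrow>
      Y \<in> cball 0 r \<Longrightarrow> norm (fst S - kalman_gain C S Y ** C) \<le> d"
    "\<And>(S :: ('n, 'm, 'r) params) S' Y Y'. S \<in> {S. uniformly_admissible \<epsilon> \<rho> S} \<Longrightarrow>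
      S' \<in> {S. uniformly_admissible \<epsilon> \<rho> S} \<Longrightarrow> Y \<in> cball 0 r \<Longrightarrow> Y' \<in> cball 0 r \<Longrightarrow>
      norm ((fst S - kalman_gain C S Y ** C) - (fst S' - kalman_gain C S' Y' ** C))
        \<le> d * (dist S S' + dist Y Y')"
    by (rule bounded_lipschitz_on_prodE[OF bounded_lipschitz_on_observer_drift[OF \<epsilon>, of \<rho> r C]])
      (rule that, assumption, blast, blast)
  obtain l where l: "0 \<le> l"
    "\<And>S S' X X' t. uniformly_admissible \<epsilon> \<rho> S \<Longrightarrow> riccati_solution T B C S X \<Longrightarrow>
       uniformly_admissible \<epsilon> \<rho> S' \<Longrightarrow> riccati_solution T B C S' X' \<Longrightarrow> t \<in> {0..T} \<Longrightarrow>
       dist (X t) (X' t) \<le> l * dist S S'"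
    by (rule riccati_solution_lipschitz[OF \<epsilon> \<rho> T, of B C]) (rule that, assumption, blast)
  obtain M where M: "0 \<le> M"
    "\<And>S X xh t. uniformly_admissible \<epsilon> \<rho> S \<Longrightarrow> riccati_solution T B C S X \<Longrightarrow>
       observer_solution T C x0 y S X xh \<Longrightarrow> t \<in> {0..T} \<Longrightarrow> norm (xh t) \<le> M"
    by (rule observer_solution_norm_bound[OF \<epsilon> \<rho> T y, of B C x0]) (rule that, assumption, blast)
  define h where "h s = (1 + l) * (d * M + g * norm (y s))" for s
  have hint: "h integrable_on {0..T}"
    using L2_on_imp_absolutely_integrable[OF y] unfolding h_def
    by (intro integrable_on_mult_right integrable_add integrable_const_ivl)
      (simp add: absolutely_integrable_on_def)
  have h0: "0 \<le> h s" for s using g(1) d(1) l(1) M(1) by (simp add: h_def)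
  show thesis
  proof (rule that)
    show "0 \<le> integral {0..T} h * exp (d * T)"
      using integral_nonneg[OF hint] h0 by simp
    fix S S' X X' xh xh' t
    assume S: "uniformly_admissible \<epsilon> \<rho> S" and X: "riccati_solution T B C S X"
      and xh: "observer_solution T C x0 y S X xh"
      and S': "uniformly_admissible \<epsilon> \<rho> S'" and X': "riccati_solution T B C S' X'"
      and xh': "observer_solution T C x0 y S' X' xh'" and t: "t \<in> {0..T}"
    obtain v N where v: "xh 0 = x0" "v integrable_on {0..T}"
      "\<And>t. t \<in> {0..T} \<Longrightarrow> xh t = xh 0 + integral {0..t} v" "negligible N"
      "\<And>s. s \<in> {0..T} - N \<Longrightarrow>
       v s = (fst S - kalman_gain C S (X s) ** C) *v xh s + kalman_gain C S (X s) *v y s"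
      by (rule observer_solution_integral_form[OF xh]) blast
    obtain v' N' where v': "xh' 0 = x0" "v' integrable_on {0..T}"
      "\<And>t. t \<in> {0..T} \<Longrightarrow> xh' t = xh' 0 + integral {0..t} v'" "negligible N'"
      "\<And>s. s \<in> {0..T} - N' \<Longrightarrow>
       v' s = (fst S' - kalman_gain C S' (X' s) ** C) *v xh' s + kalman_gain C S' (X' s) *v y s"
      by (rule observer_solution_integral_form[OF xh']) blast
    have "norm (xh t - xh' t)
        \<le> (norm (xh 0 - xh' 0) + integral {0..T} (\<lambda>s. dist S S' * h s)) * exp (d * T)"
    proof (rule gronwall_absolutely_continuous[where v = "\<lambda>s. v s - v' s" and N = "N \<union> N'"
          and f = "\<lambda>s. xh s - xh' s", OF _ _ _ _ _ _ d(1) t])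
      fix s assume s: "s \<in> {0..T}"
      have sub: "{0..s} \<subseteq> {0..T}" using s by auto
      have "integral {0..s} (\<lambda>s. v s - v' s) = integral {0..s} v - integral {0..s} v'"
        using integrable_on_subinterval[OF v(2) sub] integrable_on_subinterval[OF v'(2) sub]
        by (rule integral_diff)
      then show "xh s - xh' s = xh 0 - xh' 0 + integral {0..s} (\<lambda>s. v s - v' s)"
        using v(3)[OF s] v'(3)[OF s] by (simp add: algebra_simps)
    next
      fix s assume s: "s \<in> {0..T} - (N \<union> N')"
      then have sT: "s \<in> {0..T}" and vs: "s \<in> {0..T} - N" "s \<in> {0..T} - N'" by auto
      let ?G = "kalman_gain C S (X s)" and ?G' = "kalman_gain C S' (X' s)"
      let ?D = "fst S - ?G ** C" and ?D' = "fst S' - ?G' ** C"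
      note XX = r[OF S X sT] r[OF S' X' sT]
      have dist: "dist S S' + dist (X s) (X' s) \<le> (1 + l) * dist S S'"
        using l(2)[OF S X S' X' sT] by (simp add: algebra_simps)
      have "norm (?D - ?D') \<le> d * ((1 + l) * dist S S')"
        using d(3)[of S S' "X s" "X' s"] XX S S' mult_left_mono[OF dist d(1)] by simp
      then have 1: "norm ((?D - ?D') *v xh' s) \<le> d * ((1 + l) * dist S S') * M"
        using M(2)[OF S' X' xh' sT] d(1) l(1)
        by (intro order_trans[OF norm_matrix_vector_mult_le] mult_mono) auto
      have "norm (?G - ?G') \<le> g * ((1 + l) * dist S S')"
        using g(2)[of S S' "X s" "X' s"] XX S S' mult_left_mono[OF dist g(1)] by simp
      then have 2: "norm ((?G - ?G') *v y s) \<le> g * ((1 + l) * dist S S') * norm (y s)"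
        by (intro order_trans[OF norm_matrix_vector_mult_le] mult_right_mono) auto
      have 3: "norm (?D *v (xh s - xh' s)) \<le> d * norm (xh s - xh' s)"
        using d(2)[of S "X s"] XX S
        by (intro order_trans[OF norm_matrix_vector_mult_le] mult_right_mono) auto
      have "v s - v' s = ?D *v (xh s - xh' s) + ((?D - ?D') *v xh' s + (?G - ?G') *v y s)"
        unfolding v(5)[OF vs(1)] v'(5)[OF vs(2)] matrix_vector_mult_diff_distrib
          matrix_vector_mult_diff_rdistrib[of ?D] matrix_vector_mult_diff_rdistrib[of ?G]
        by simp
      also have "norm \<dots> \<le> d * norm (xh s - xh' s)
          + (d * ((1 + l) * dist S S') * M + g * ((1 + l) * dist S S') * norm (y s))"
        by (intro order_trans[OF norm_triangle_ineq] add_mono 1 2 3)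
      also have "\<dots> = d * norm (xh s - xh' s) + dist S S' * h s"
        by (simp add: h_def algebra_simps)
      finally show "norm (v s - v' s) \<le> d * norm (xh s - xh' s) + dist S S' * h s" .
    qed (use v(2,4) v'(2,4) hint h0 in
        \<open>auto intro!: integrable_diff integrable_on_mult_right negligible_Un\<close>)
    then show "norm (xh t - xh' t) \<le> integral {0..T} h * exp (d * T) * dist S S'"
      by (simp add: v(1) v'(1) mult_ac)
  qed
qed

section \<open>Minimisers of aggregated quadratic costs\<close>

lemma quadratic_cost_along_segment:
  fixes P :: "real^'n^'n"
  assumes "transpose P = P"
  shows "wnorm_sq P (x - s *\<^sub>R d - z)
    = wnorm_sq P (x - z) - 2 * s * (d \<bullet> (P *v (x - z))) + s\<^sup>2 * (d \<bullet> (P *v d))"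
proof -
  have "x - s *\<^sub>R d - z = (x - z) - s *\<^sub>R d" by simp
  moreover have "(x - z) \<bullet> (P *v d) = d \<bullet> (P *v (x - z))"
    using inner_symmetric_matrix[OF assms, of "x - z" d] by (simp add: inner_commute)
  ultimately show ?thesis
    unfolding wnorm_sq_def
    by (simp only: matrix_vector_mult_diff_distrib[of P "x - z"] matrix_vector_mult_scaleR
        inner_diff_left inner_diff_right inner_scaleR_left inner_scaleR_right)
      (simp add: algebra_simps power2_eq_square)
qed

text \<open>The value functions at a fixed time \<open>t\<close>, with the accumulated output misfit as the offset \<open>c k\<close>.
The weights \<open>P k\<close> are pinched between \<open>\<alpha>\<close> and \<open>b\<close>, and \<open>zbar\<close> is an arbitrary reference point
to which the minimisers of the aggregated costs are compared.\<close>

locale quadratic_costs =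
  fixes \<Sigma> :: "'s set" and P :: "'s \<Rightarrow> real^'n^'n" and z :: "'s \<Rightarrow> real^'n" and c :: "'s \<Rightarrow> real"
    and \<alpha> b :: real and zbar :: "real^'n"
    and V :: "'s \<Rightarrow> real \<Rightarrow> real^'n \<Rightarrow> real" and t :: real
  assumes fin: "finite \<Sigma>" and ne: "\<Sigma> \<noteq> {}"
    and P: "\<And>k. k \<in> \<Sigma> \<Longrightarrow> coercive \<alpha> (P k)" and \<alpha>: "0 < \<alpha>"
    and b: "\<And>k x. k \<in> \<Sigma> \<Longrightarrow> norm (P k *v x) \<le> b * norm x" and b0: "0 \<le> b"
    and V: "\<And>k x. k \<in> \<Sigma> \<Longrightarrow> V k t x = wnorm_sq (P k) (x - z k) + c k"
begin

lemma cost_along_segment: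
  assumes "k \<in> \<Sigma>"
  shows "V k t (x - s *\<^sub>R (x - zbar)) = V k t x
    - 2 * s * ((x - zbar) \<bullet> (P k *v (x - z k))) + s\<^sup>2 * ((x - zbar) \<bullet> (P k *v (x - zbar)))"
  using quadratic_cost_along_segment[of "P k" x s "x - zbar" "z k"] P[OF assms]
  by (simp add: V[OF assms] coercive_def)

text \<open>The right-hand side is half the derivative of the cost \<open>k\<close> in the direction \<open>x - zbar\<close>. It is positive as soon as \<open>x\<close> is
farther from \<open>zbar\<close> than \<open>b / \<alpha>\<close> times the distance from \<open>zbar\<close> to the centre \<open>z k\<close>.\<close>

lemma slope_lower_bound:
  assumes k: "k \<in> \<Sigma>"
  shows "norm (x - zbar) * (\<alpha> * norm (x - zbar) - b * norm (z k - zbar))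
    \<le> (x - zbar) \<bullet> (P k *v (x - z k))"
proof -
  let ?d = "x - zbar"
  have "\<alpha> * (norm ?d)\<^sup>2 \<le> ?d \<bullet> (P k *v ?d)"
    using P[OF k] by (simp add: coercive_def)
  moreover have "?d \<bullet> (P k *v (z k - zbar)) \<le> norm ?d * (b * norm (z k - zbar))"
    by (intro order_trans[OF norm_cauchy_schwarz] mult_left_mono b[OF k]) simp
  moreover have "?d \<bullet> (P k *v (x - z k)) = ?d \<bullet> (P k *v ?d) - ?d \<bullet> (P k *v (z k - zbar))"
    by (simp add: inner_diff_right[symmetric] matrix_vector_mult_diff_distrib[symmetric])
  ultimately show ?thesis
    by (simp add: power2_eq_square algebra_simps)
qed

text \<open>If \<open>x\<close> is farther from \<open>zbar\<close> than \<open>b e / \<alpha>\<close>, a short step towards \<open>zbar\<close> lowers every single cost, hence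
every monotone aggregate of the costs. This replaces subdifferential calculus for the maximum.\<close>

lemma common_descent:
  assumes e: "\<And>k. k \<in> \<Sigma> \<Longrightarrow> norm (z k - zbar) \<le> e" and far: "b * e < \<alpha> * norm (x - zbar)"
  obtains x' where "\<And>k. k \<in> \<Sigma> \<Longrightarrow> V k t x' < V k t x"
proof -
  let ?d = "x - zbar"
  define \<gamma> where "\<gamma> = norm ?d * (\<alpha> * norm ?d - b * e)"
  have "0 \<le> e" using e ne norm_ge_zero order_trans by (metis ex_in_conv)
  then have "?d \<noteq> 0" using far b0 by (auto simp: mult_less_0_iff)
  then have "0 < \<gamma>" using far by (simp add: \<gamma>_def)
  \<comment> \<open>short enough that the gain \<open>2 s \<gamma>\<close> exceeds the curvature term, at most \<open>s\<^sup>2 b \<parallel>d\<parallel>\<^sup>2\<close>\<close>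
  define s where "s = \<gamma> / (b * (norm ?d)\<^sup>2 + 1)"
  have den: "0 < b * (norm ?d)\<^sup>2 + 1" using b0 by (intro add_nonneg_pos) auto
  then have "0 < s" using \<open>0 < \<gamma>\<close> by (simp add: s_def)
  have sb: "s * (b * (norm ?d)\<^sup>2) < \<gamma>"
    using den \<open>0 < \<gamma>\<close> by (simp add: s_def field_simps)
  show thesis
  proof (rule that)
    fix k assume k: "k \<in> \<Sigma>"
    have "b * norm (z k - zbar) \<le> b * e" using e[OF k] b0 by (rule mult_left_mono)
    then have "\<gamma> \<le> norm ?d * (\<alpha> * norm ?d - b * norm (z k - zbar))"
      unfolding \<gamma>_def by (intro mult_left_mono) auto
    with slope_lower_bound[OF k, of x] have slope: "\<gamma> \<le> ?d \<bullet> (P k *v (x - z k))" by linarith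
    have "?d \<bullet> (P k *v ?d) \<le> norm ?d * (b * norm ?d)"
      by (intro order_trans[OF norm_cauchy_schwarz] mult_left_mono b[OF k]) simp
    then have "s * (?d \<bullet> (P k *v ?d)) \<le> s * (b * (norm ?d)\<^sup>2)"
      using \<open>0 < s\<close> by (simp add: power2_eq_square mult_ac)
    with sb slope \<open>0 < \<gamma>\<close> have "s * (?d \<bullet> (P k *v ?d)) - 2 * (?d \<bullet> (P k *v (x - z k))) < 0"
      by linarith
    with \<open>0 < s\<close> have "s * (s * (?d \<bullet> (P k *v ?d)) - 2 * (?d \<bullet> (P k *v (x - z k)))) < 0"
      by (simp add: mult_less_0_iff)
    then show "V k t (x - s *\<^sub>R ?d) < V k t x"
      unfolding cost_along_segment[OF k] by (simp add: algebra_simps power2_eq_square)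
  qed
qed

lemma max_cost_minimiser_bound:
  assumes min: "is_arg_min (max_cost \<Sigma> V t) (\<lambda>_. True) x"
    and e: "\<And>k. k \<in> \<Sigma> \<Longrightarrow> norm (z k - zbar) \<le> e"
  shows "\<alpha> * norm (x - zbar) \<le> b * e"
proof (rule ccontr)
  assume "\<not> ?thesis"
  then obtain x' where x': "\<And>k. k \<in> \<Sigma> \<Longrightarrow> V k t x' < V k t x"
    using common_descent[OF e, of x] by (metis not_le)
  have "max_cost \<Sigma> V t x' < max_cost \<Sigma> V t x"
    unfolding max_cost_def using fin ne x'
    by (subst Max_less_iff) (auto simp: Max_gr_iff)
  with min show False by (simp add: is_arg_min_def)
qed

lemma exp_sum_pos: "0 < (\<Sum>k\<in>\<Sigma>. exp (\<theta> * V k t x))"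
  using fin ne by (intro sum_pos) auto

lemma exp_cost_less_iff:
  assumes "0 < \<theta>"
  shows "exp_cost \<theta> \<Sigma> V t x' < exp_cost \<theta> \<Sigma> V t x \<longleftrightarrow>
    (\<Sum>k\<in>\<Sigma>. exp (\<theta> * V k t x')) < (\<Sum>k\<in>\<Sigma>. exp (\<theta> * V k t x))"
proof -
  have "0 < real (card \<Sigma>)" using fin ne by (simp add: card_gt_0_iff)
  then show ?thesis
    using assms exp_sum_pos[of \<theta> x] exp_sum_pos[of \<theta> x']
    by (simp add: exp_cost_def divide_less_cancel)
qed

lemma exp_cost_minimiser_bound:
  assumes \<theta>: "0 < \<theta>" and min: "is_arg_min (exp_cost \<theta> \<Sigma> V t) (\<lambda>_. True) x"
    and e: "\<And>k. k \<in> \<Sigma> \<Longrightarrow> norm (z k - zbar) \<le> e"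
  shows "\<alpha> * norm (x - zbar) \<le> b * e"
proof (rule ccontr)
  assume "\<not> ?thesis"
  then obtain x' where x': "\<And>k. k \<in> \<Sigma> \<Longrightarrow> V k t x' < V k t x"
    using common_descent[OF e, of x] by (metis not_le)
  have "(\<Sum>k\<in>\<Sigma>. exp (\<theta> * V k t x')) < (\<Sum>k\<in>\<Sigma>. exp (\<theta> * V k t x))"
    using fin ne x' \<theta> by (intro sum_strict_mono) auto
  with min exp_cost_less_iff[OF \<theta>] show False by (auto simp: is_arg_min_def)
qed

text \<open>Fermat's rule for the sum of exponentials restricted to the line through \<open>x\<close> and \<open>zbar\<close>, on which every
cost is a quadratic polynomial.\<close>

lemma exp_cost_minimiser_stationary:
  assumes \<theta>: "0 < \<theta>" and min: "is_arg_min (exp_cost \<theta> \<Sigma> V t) (\<lambda>_. True) x"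
  shows "(\<Sum>k\<in>\<Sigma>. exp (\<theta> * V k t x) * ((x - zbar) \<bullet> (P k *v (x - z k)))) = 0"
proof -
  let ?d = "x - zbar"
  define F where "F s = (\<Sum>k\<in>\<Sigma>. exp (\<theta> * V k t (x - s *\<^sub>R ?d)))" for s
  have F_eq: "F = (\<lambda>s. \<Sum>k\<in>\<Sigma>. exp (\<theta> * (V k t x - 2 * s * (?d \<bullet> (P k *v (x - z k)))
      + s\<^sup>2 * (?d \<bullet> (P k *v ?d)))))"
    unfolding F_def by (intro ext sum.cong refl) (simp add: cost_along_segment)
  have "DERIV F 0 :> (\<Sum>k\<in>\<Sigma>. exp (\<theta> * V k t x) * (\<theta> * (- 2 * (?d \<bullet> (P k *v (x - z k))))))"
    unfolding F_eq by (auto intro!: derivative_eq_intros sum.cong)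
  moreover have "F 0 \<le> F s" for s
  proof -
    have "\<not> exp_cost \<theta> \<Sigma> V t (x - s *\<^sub>R ?d) < exp_cost \<theta> \<Sigma> V t x"
      using min by (simp add: is_arg_min_def)
    then show ?thesis by (simp add: exp_cost_less_iff[OF \<theta>] F_def)
  qed
  ultimately have "(\<Sum>k\<in>\<Sigma>. exp (\<theta> * V k t x) * (\<theta> * (- 2 * (?d \<bullet> (P k *v (x - z k)))))) = 0"
    using DERIV_local_min[of F _ 0 1] by simp
  also have "(\<Sum>k\<in>\<Sigma>. exp (\<theta> * V k t x) * (\<theta> * (- 2 * (?d \<bullet> (P k *v (x - z k))))))
      = (- 2 * \<theta>) * (\<Sum>k\<in>\<Sigma>. exp (\<theta> * V k t x) * (?d \<bullet> (P k *v (x - z k))))"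
    unfolding sum_distrib_left by (intro sum.cong) auto
  finally show ?thesis using \<theta> by simp
qed

lemma value_gap_ge:
  assumes "k \<in> \<Sigma>" "j \<in> \<Sigma>"
  shows "V k t x - V j t x \<le> value_gap \<Sigma> V t x"
  unfolding value_gap_def by (rule Max_ge) (use fin assms in force)+

text \<open>Stationarity turns the lower bounds of the slopes into a bound by the mean of the distances
\<open>\<parallel>z k - zbar\<parallel>\<close> for the normalised Gibbs weights. Two weights differ at most by the factor
\<open>exp (\<theta> J)\<close>, where \<open>J\<close> is the value gap, so each normalised weight is at most \<open>exp (\<theta> J) / N\<close>.\<close>

lemma exp_cost_minimiser_mean_bound:
  assumes \<theta>: "0 < \<theta>" and min: "is_arg_min (exp_cost \<theta> \<Sigma> V t) (\<lambda>_. True) x"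
  shows "\<alpha> * norm (x - zbar)
    \<le> b * (exp (\<theta> * value_gap \<Sigma> V t x) * uniform_mean \<Sigma> (\<lambda>k. norm (z k - zbar)))"
proof -
  let ?d = "x - zbar"
  define w where "w k = exp (\<theta> * V k t x)" for k
  define W where "W = (\<Sum>k\<in>\<Sigma>. w k)"
  define N where "N = real (card \<Sigma>)"
  have "0 < N" using fin ne by (simp add: N_def card_gt_0_iff)
  have "0 < W" unfolding W_def w_def by (rule exp_sum_pos)
  have w0: "0 < w k" for k by (simp add: w_def)
  have "norm ?d * (\<alpha> * norm ?d * W - b * (\<Sum>k\<in>\<Sigma>. w k * norm (z k - zbar)))
      = (\<Sum>k\<in>\<Sigma>. w k * (norm ?d * (\<alpha> * norm ?d - b * norm (z k - zbar))))"
    unfolding W_def sum_distrib_left sum_subtractf[symmetric]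
    by (intro sum.cong) (auto simp: algebra_simps)
  also have "\<dots> \<le> (\<Sum>k\<in>\<Sigma>. w k * (?d \<bullet> (P k *v (x - z k))))"
    by (intro sum_mono mult_left_mono slope_lower_bound less_imp_le[OF w0])
  also have "\<dots> = 0"
    unfolding w_def by (rule exp_cost_minimiser_stationary[OF \<theta> min])
  finally have le0: "norm ?d * (\<alpha> * norm ?d * W - b * (\<Sum>k\<in>\<Sigma>. w k * norm (z k - zbar))) \<le> 0" .
  have weighted: "\<alpha> * norm ?d * W \<le> b * (\<Sum>k\<in>\<Sigma>. w k * norm (z k - zbar))"
  proof (cases "?d = 0")
    case True
    have "0 \<le> b * (\<Sum>k\<in>\<Sigma>. w k * norm (z k - zbar))"
      using b0 less_imp_le[OF w0] by (intro mult_nonneg_nonneg sum_nonneg) auto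
    with True show ?thesis by simp
  next
    case False
    then have "0 < norm ?d" by simp
    with le0 show ?thesis by (simp add: mult_le_0_iff)
  qed
  have w_le: "w k * N \<le> exp (\<theta> * value_gap \<Sigma> V t x) * W" if k: "k \<in> \<Sigma>" for k
  proof -
    have "w k \<le> exp (\<theta> * value_gap \<Sigma> V t x) * w j" if j: "j \<in> \<Sigma>" for j
    proof -
      have "\<theta> * V k t x \<le> \<theta> * (value_gap \<Sigma> V t x + V j t x)"
        using value_gap_ge[OF k j, of x] \<theta> by (intro mult_left_mono) auto
      then show ?thesis by (simp add: w_def distrib_left flip: exp_add)
    qed
    then have "(\<Sum>j\<in>\<Sigma>. w k) \<le> (\<Sum>j\<in>\<Sigma>. exp (\<theta> * value_gap \<Sigma> V t x) * w j)"
      by (rule sum_mono)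
    then show ?thesis
      unfolding W_def N_def sum_distrib_left by (simp add: mult.commute)
  qed
  have "(\<Sum>k\<in>\<Sigma>. w k * norm (z k - zbar))
      \<le> (\<Sum>k\<in>\<Sigma>. (exp (\<theta> * value_gap \<Sigma> V t x) * W / N) * norm (z k - zbar))"
    using w_le \<open>0 < N\<close> by (intro sum_mono mult_right_mono) (auto simp: pos_le_divide_eq)
  also have "\<dots> = exp (\<theta> * value_gap \<Sigma> V t x) * uniform_mean \<Sigma> (\<lambda>k. norm (z k - zbar)) * W"
    by (simp only: uniform_mean_def N_def sum_distrib_left[symmetric]) (simp add: mult_ac)
  finally have "b * (\<Sum>k\<in>\<Sigma>. w k * norm (z k - zbar))
      \<le> b * (exp (\<theta> * value_gap \<Sigma> V t x) * uniform_mean \<Sigma> (\<lambda>k. norm (z k - zbar)) * W)"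
    using b0 by (rule mult_left_mono)
  with weighted have "(\<alpha> * norm ?d) * W
      \<le> (b * (exp (\<theta> * value_gap \<Sigma> V t x) * uniform_mean \<Sigma> (\<lambda>k. norm (z k - zbar)))) * W"
    by (simp add: mult_ac)
  with \<open>0 < W\<close> show ?thesis by (simp add: mult_le_cancel_right)
qed

lemma wnorm_le_of_norm_le:
  assumes k: "k \<in> \<Sigma>" and le: "\<alpha> * norm d \<le> b * (L * m)"
  shows "wnorm (P k) d \<le> (sqrt b * (b / \<alpha>) * L) * m"
proof -
  have "wnorm_sq (P k) d \<le> norm d * (b * norm d)"
    unfolding wnorm_sq_def
    by (intro order_trans[OF norm_cauchy_schwarz] mult_left_mono b[OF k]) simp
  then have "wnorm (P k) d \<le> sqrt (b * (norm d)\<^sup>2)"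
    unfolding wnorm_def by (simp add: power2_eq_square mult_ac)
  also have "\<dots> = sqrt b * norm d" by (simp add: real_sqrt_mult)
  also have "\<dots> \<le> sqrt b * (b / \<alpha> * (L * m))"
    using le \<alpha> b0 by (intro mult_left_mono) (auto simp: field_simps)
  finally show ?thesis by (simp add: mult_ac)
qed

lemma minimiser_weighted_norm_bounds:
  assumes kbar: "kbar \<in> \<Sigma>"
    and \<delta>: "\<And>k. k \<in> \<Sigma> \<Longrightarrow> norm (z k - zbar) \<le> L * \<delta> k" and L: "0 \<le> L"
  shows "is_arg_min (max_cost \<Sigma> V t) (\<lambda>_. True) x \<Longrightarrow>
      wnorm (P kbar) (x - zbar) \<le> (sqrt b * (b / \<alpha>) * L) * (MAX k\<in>\<Sigma>. \<delta> k)"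
    and "0 < \<theta> \<Longrightarrow> is_arg_min (exp_cost \<theta> \<Sigma> V t) (\<lambda>_. True) x \<Longrightarrow>
      wnorm (P kbar) (x - zbar) \<le> (sqrt b * (b / \<alpha>) * L) * (MAX k\<in>\<Sigma>. \<delta> k)"
    and "0 < \<theta> \<Longrightarrow> is_arg_min (exp_cost \<theta> \<Sigma> V t) (\<lambda>_. True) x \<Longrightarrow>
      wnorm (P kbar) (x - zbar)
        \<le> (sqrt b * (b / \<alpha>) * L) * (exp (\<theta> * value_gap \<Sigma> V t x) * uniform_mean \<Sigma> \<delta>)"
proof -
  have max: "norm (z k - zbar) \<le> L * (MAX k\<in>\<Sigma>. \<delta> k)" if "k \<in> \<Sigma>" for k
    using \<delta>[OF that] fin that L
    by (intro order_trans[OF \<delta>[OF that]] mult_left_mono Max_ge) auto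
  show "wnorm (P kbar) (x - zbar) \<le> (sqrt b * (b / \<alpha>) * L) * (MAX k\<in>\<Sigma>. \<delta> k)"
    if "is_arg_min (max_cost \<Sigma> V t) (\<lambda>_. True) x"
    by (rule wnorm_le_of_norm_le[OF kbar max_cost_minimiser_bound[OF that max]])
  show "wnorm (P kbar) (x - zbar) \<le> (sqrt b * (b / \<alpha>) * L) * (MAX k\<in>\<Sigma>. \<delta> k)"
    if "0 < \<theta>" "is_arg_min (exp_cost \<theta> \<Sigma> V t) (\<lambda>_. True) x"
    by (rule wnorm_le_of_norm_le[OF kbar exp_cost_minimiser_bound[OF that max]])
  show "wnorm (P kbar) (x - zbar)
        \<le> (sqrt b * (b / \<alpha>) * L) * (exp (\<theta> * value_gap \<Sigma> V t x) * uniform_mean \<Sigma> \<delta>)"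
    if "0 < \<theta>" "is_arg_min (exp_cost \<theta> \<Sigma> V t) (\<lambda>_. True) x"
  proof (rule wnorm_le_of_norm_le[OF kbar])
    have "(\<Sum>k\<in>\<Sigma>. norm (z k - zbar)) \<le> (\<Sum>k\<in>\<Sigma>. L * \<delta> k)"
      by (rule sum_mono) (rule \<delta>)
    then have "uniform_mean \<Sigma> (\<lambda>k. norm (z k - zbar)) \<le> L * uniform_mean \<Sigma> \<delta>"
      by (simp add: uniform_mean_def divide_right_mono flip: sum_distrib_left)
    then have "b * (exp (\<theta> * value_gap \<Sigma> V t x) * uniform_mean \<Sigma> (\<lambda>k. norm (z k - zbar)))
        \<le> b * (exp (\<theta> * value_gap \<Sigma> V t x) * (L * uniform_mean \<Sigma> \<delta>))"
      using b0 by (intro mult_left_mono) auto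
    with exp_cost_minimiser_mean_bound[OF that]
    show "\<alpha> * norm (x - zbar) \<le> b * (L * (exp (\<theta> * value_gap \<Sigma> V t x) * uniform_mean \<Sigma> \<delta>))"
      by (simp add: mult_ac)
  qed
qed

end

section \<open>Equivalence of norms\<close>

text \<open>The minimum of \<open>\<nu>\<close> over the Euclidean unit sphere is positive by compactness.\<close>

lemma is_norm_equivalence:
  fixes \<nu> :: "'a::euclidean_space \<Rightarrow> real"
  assumes "is_norm \<nu>"
  obtains k where "0 < k" "\<And>x. norm x \<le> k * \<nu> x"
proof -
  have nonneg: "0 \<le> \<nu> x" and zero: "\<nu> x = 0 \<longleftrightarrow> x = 0" and scale: "\<nu> (a *\<^sub>R x) = \<bar>a\<bar> * \<nu> x"
    and triangle: "\<nu> (x + y) \<le> \<nu> x + \<nu> y" for a x y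
    using assms by (auto simp: is_norm_def)
  have sum_le: "\<nu> (\<Sum>i\<in>I. f i) \<le> (\<Sum>i\<in>I. \<nu> (f i))" if "finite I" for I :: "'a set" and f
    using that
  proof induction
    case empty
    then show ?case using zero[of 0] by simp
  next
    case (insert i I)
    then show ?case using triangle[of "f i" "\<Sum>i\<in>I. f i"] by simp
  qed
  define L where "L = (\<Sum>i\<in>Basis. \<nu> i)"
  have upper: "\<nu> x \<le> L * norm x" for x :: 'a
  proof -
    have "\<nu> x = \<nu> (\<Sum>i\<in>Basis. (x \<bullet> i) *\<^sub>R i)" by (simp add: euclidean_representation)
    also have "\<dots> \<le> (\<Sum>i\<in>Basis. \<nu> ((x \<bullet> i) *\<^sub>R i))" by (rule sum_le) simp
    also have "\<dots> \<le> (\<Sum>i\<in>Basis. norm x * \<nu> i)"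
      unfolding scale by (intro sum_mono mult_right_mono Basis_le_norm nonneg)
    finally show ?thesis by (simp add: L_def sum_distrib_left mult.commute)
  qed
  have "0 \<le> L" unfolding L_def by (intro sum_nonneg nonneg)
  have "L-lipschitz_on (sphere 0 1) \<nu>"
  proof (rule lipschitz_onI[OF _ \<open>0 \<le> L\<close>])
    fix x y :: 'a
    have "\<nu> x \<le> \<nu> y + \<nu> (x - y)" "\<nu> y \<le> \<nu> x + \<nu> (y - x)"
      using triangle[of y "x - y"] triangle[of x "y - x"] by auto
    then show "dist (\<nu> x) (\<nu> y) \<le> L * dist x y"
      using upper[of "x - y"] upper[of "y - x"] by (simp add: dist_norm norm_minus_commute abs_le_iff)
  qed
  then have "continuous_on (sphere 0 1) \<nu>" by (rule lipschitz_on_continuous_on)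
  moreover obtain e :: 'a where "e \<in> Basis" using nonempty_Basis by blast
  then have "sphere (0::'a) 1 \<noteq> {}" by (auto intro!: exI[of _ e])
  ultimately obtain u where u: "u \<in> sphere 0 1" and min: "\<forall>x\<in>sphere 0 1. \<nu> u \<le> \<nu> x"
    using continuous_attains_inf[OF compact_sphere] by blast
  have "u \<noteq> 0" using u by auto
  then have pos: "0 < \<nu> u" using nonneg[of u] zero[of u] by linarith
  have "norm x \<le> (1 / \<nu> u) * \<nu> x" for x
  proof (cases "x = 0")
    case False
    then have "\<nu> u \<le> \<nu> (x /\<^sub>R norm x)" using min by simp
    also have "\<dots> = \<nu> x / norm x" by (simp add: scale divide_inverse mult.commute)
    finally show ?thesis using False pos by (simp add: field_simps)
  qed (simp add: nonneg)
  with pos show thesis by (intro that[of "1 / \<nu> u"]) auto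
qed

text \<open>Translates between the product norm, for which the Lipschitz estimates are proved, and the norm in which
parameter deviations are measured.\<close>

lemma params_norm_equivalence:
  fixes \<nu>n :: "real^'n^'n \<Rightarrow> real" and \<nu>m :: "real^'m^'m \<Rightarrow> real" and \<nu>r :: "real^'r^'r \<Rightarrow> real"
  assumes "is_norm \<nu>n" "is_norm \<nu>m" "is_norm \<nu>r"
  obtains k where "0 < k" "\<And>D :: ('n, 'm, 'r) params. norm D \<le> k * params_norm \<nu>n \<nu>m \<nu>r D"
proof -
  obtain kn where kn: "0 < kn" "\<And>x. norm x \<le> kn * \<nu>n x" by (rule is_norm_equivalence[OF assms(1)]) blast
  obtain km where km: "0 < km" "\<And>x. norm x \<le> km * \<nu>m x" by (rule is_norm_equivalence[OF assms(2)]) blast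
  obtain kr where kr: "0 < kr" "\<And>x. norm x \<le> kr * \<nu>r x" by (rule is_norm_equivalence[OF assms(3)]) blast
  define k where "k = kn + km + kr"
  have nonneg: "0 \<le> \<nu>n x" "0 \<le> \<nu>m x'" "0 \<le> \<nu>r x''" for x x' x''
    using assms by (auto simp: is_norm_def)
  have le: "norm x \<le> k * \<nu>n x" "norm x' \<le> k * \<nu>m x'" "norm x'' \<le> k * \<nu>r x''" for x x' x''
    using kn(2)[of x] km(2)[of x'] kr(2)[of x''] kn(1) km(1) kr(1)
      mult_right_mono[OF _ nonneg(1), of kn k x] mult_right_mono[OF _ nonneg(2), of km k x']
      mult_right_mono[OF _ nonneg(3), of kr k x'']
    by (auto simp: k_def)
  have "norm D \<le> k * params_norm \<nu>n \<nu>m \<nu>r D" for D :: "('n, 'm, 'r) params"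
  proof -
    obtain A \<Gamma> R Q where D: "D = (A, \<Gamma>, R, Q)" by (metis prod_cases4)
    have "norm D \<le> norm A + (norm \<Gamma> + (norm R + norm Q))"
      using norm_Pair_le[of A "(\<Gamma>, R, Q)"] norm_Pair_le[of \<Gamma> "(R, Q)"] norm_Pair_le[of R Q]
      unfolding D by linarith
    also have "\<dots> \<le> k * \<nu>n A + (k * \<nu>n \<Gamma> + (k * \<nu>m R + k * \<nu>r Q))"
      by (intro add_mono le)
    finally show ?thesis by (simp add: D algebra_simps)
  qed
  moreover have "0 < k" using kn km kr by (simp add: k_def)
  ultimately show thesis using that by blast
qed

theorem proposition5p4:
  fixes T :: real
    and B :: "real^'m^'n" and C :: "real^'n^'r"
    and x0 :: "real^'n" and y :: "real \<Rightarrow> real^'r"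
    and K :: "('n::finite, 'm::finite, 'r::finite) params set"
    and \<nu>n :: "real^'n^'n \<Rightarrow> real" and \<nu>m :: "real^'m^'m \<Rightarrow> real" and \<nu>r :: "real^'r^'r \<Rightarrow> real"
  assumes "T > 0"
    and "L2_on T y"
    and "is_norm \<nu>n" and "is_norm \<nu>m" and "is_norm \<nu>r"
    and "compact K" and "\<forall>S\<in>K. admissible S"
  shows "\<exists>c>0. \<forall>(\<Sigma>A :: nat set) (\<Sigma>G :: nat set) (\<Sigma>R :: nat set) (\<Sigma>Q :: nat set) \<Sigma>
      (A :: nat \<Rightarrow> real^'n^'n) (\<Gamma> :: nat \<Rightarrow> real^'n^'n) (R :: nat \<Rightarrow> real^'m^'m) (Q :: nat \<Rightarrow> real^'r^'r) S
      (\<Pi>s :: nat \<times> nat \<times> nat \<times> nat \<Rightarrow> real \<Rightarrow> real^'n^'n)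
      (xh :: nat \<times> nat \<times> nat \<times> nat \<Rightarrow> real \<Rightarrow> real^'n) V
      (xinf :: real \<Rightarrow> real^'n) (xth :: real \<Rightarrow> real \<Rightarrow> real^'n) \<sigma>bar.
      finite \<Sigma>A \<and> \<Sigma>A \<noteq> {} \<and> finite \<Sigma>G \<and> \<Sigma>G \<noteq> {} \<and>
      finite \<Sigma>R \<and> \<Sigma>R \<noteq> {} \<and> finite \<Sigma>Q \<and> \<Sigma>Q \<noteq> {} \<and>
      \<Sigma> = \<Sigma>A \<times> \<Sigma>G \<times> \<Sigma>R \<times> \<Sigma>Q \<and>
      S = tuple_of A \<Gamma> R Q \<and>
      (\<forall>\<sigma>\<in>\<Sigma>. S \<sigma> \<in> K) \<and>
      (\<forall>\<sigma>\<in>\<Sigma>. riccati_solution T B C (S \<sigma>) (\<Pi>s \<sigma>)) \<and>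
      (\<forall>\<sigma>\<in>\<Sigma>. observer_solution T C x0 y (S \<sigma>) (\<Pi>s \<sigma>) (xh \<sigma>)) \<and>
      V = (\<lambda>\<sigma>. value_fun C y (S \<sigma>) (\<Pi>s \<sigma>) (xh \<sigma>)) \<and>
      (\<forall>t\<in>{0..T}. is_arg_min (max_cost \<Sigma> V t) (\<lambda>_. True) (xinf t)) \<and>
      (\<forall>\<theta>>0. \<forall>t\<in>{0..T}. is_arg_min (exp_cost \<theta> \<Sigma> V t) (\<lambda>_. True) (xth \<theta> t)) \<and>
      \<sigma>bar \<in> \<Sigma>
      \<longrightarrow>
      (\<forall>t\<in>{0..T}.
         wnorm (matrix_inv (\<Pi>s \<sigma>bar t)) (xinf t - xh \<sigma>bar t)
           \<le> c * (MAX \<sigma>\<in>\<Sigma>. params_norm \<nu>n \<nu>m \<nu>r (S \<sigma> - S \<sigma>bar))) \<and>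
      (\<forall>\<theta>>0. \<forall>t\<in>{0..T}.
         wnorm (matrix_inv (\<Pi>s \<sigma>bar t)) (xth \<theta> t - xh \<sigma>bar t)
           \<le> c * (MAX \<sigma>\<in>\<Sigma>. params_norm \<nu>n \<nu>m \<nu>r (S \<sigma> - S \<sigma>bar))) \<and>
      (\<forall>\<theta>>0. \<forall>t\<in>{0..T}.
         wnorm (matrix_inv (\<Pi>s \<sigma>bar t)) (xth \<theta> t - xh \<sigma>bar t)
           \<le> c * exp (\<theta> * value_gap \<Sigma> V t (xth \<theta> t))
               * uniform_mean \<Sigma> (\<lambda>\<sigma>. params_norm \<nu>n \<nu>m \<nu>r (S \<sigma> - S \<sigma>bar)))"
proof -
  obtain \<epsilon> \<rho> where \<epsilon>: "0 < \<epsilon>" and \<rho>: "0 < \<rho>" and adm: "\<And>S. S \<in> K \<Longrightarrow> uniformly_admissible \<epsilon> \<rho> S"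
    by (rule compact_admissible_imp_uniformly_admissible[OF assms(6,7)]) blast
  have T: "0 \<le> T" using assms(1) by simp
  obtain \<alpha> \<beta> where \<alpha>: "0 < \<alpha>" and \<beta>: "0 < \<beta>" and ric:
    "\<And>S X t. uniformly_admissible \<epsilon> \<rho> S \<Longrightarrow> riccati_solution T B C S X \<Longrightarrow> t \<in> {0..T} \<Longrightarrow>
       coercive \<alpha> (X t) \<and> (\<forall>x. norm (X t *v x) \<le> \<beta> * norm x)"
    by (rule riccati_solution_uniform_bounds[OF \<epsilon> \<rho> T, of B C]) blast
  obtain l where l: "0 \<le> l" and obs:
    "\<And>S S' X X' xh xh' t. uniformly_admissible \<epsilon> \<rho> S \<Longrightarrow> riccati_solution T B C S X \<Longrightarrow>
       observer_solution T C x0 y S X xh \<Longrightarrow>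
       uniformly_admissible \<epsilon> \<rho> S' \<Longrightarrow> riccati_solution T B C S' X' \<Longrightarrow>
       observer_solution T C x0 y S' X' xh' \<Longrightarrow> t \<in> {0..T} \<Longrightarrow>
       norm (xh t - xh' t) \<le> l * dist S S'"
    by (rule observer_solution_lipschitz[OF \<epsilon> \<rho> T assms(2), of B C x0]) (rule that, assumption, blast)
  obtain k where k: "0 < k" "\<And>D :: ('n, 'm, 'r) params. norm D \<le> k * params_norm \<nu>n \<nu>m \<nu>r D"
    by (rule params_norm_equivalence[OF assms(3-5)]) blast
  \<comment> \<open>\<open>1 / \<alpha>\<close> and \<open>\<alpha> / \<beta>\<^sup>2\<close> bound the spectrum of \<open>\<Pi>\<^sup>-\<^sup>1\<close>; adding \<open>1\<close> to \<open>l * k\<close> makes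
      the constant positive when the Lipschitz constant \<open>l\<close> is zero\<close>
  define c where "c = sqrt (1 / \<alpha>) * (1 / \<alpha> / (\<alpha> / \<beta>\<^sup>2)) * (l * k + 1)"
  have "0 < l * k + 1" using l k(1) by (intro add_nonneg_pos) auto
  then have "0 < c" using \<alpha> \<beta> unfolding c_def by (intro mult_pos_pos divide_pos_pos) auto
  have nonneg: "0 \<le> params_norm \<nu>n \<nu>m \<nu>r D" for D :: "('n, 'm, 'r) params"
    using k order_trans[OF norm_ge_zero k(2)[of D]] by (simp add: zero_le_mult_iff)
  show ?thesis
  proof (rule exI[of _ c], rule conjI[OF \<open>0 < c\<close>], intro allI impI, elim conjE)
    fix \<Sigma>A \<Sigma>G \<Sigma>R \<Sigma>Q :: "nat set" and \<Sigma> :: "(nat \<times> nat \<times> nat \<times> nat) set"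
      and A \<Gamma> :: "nat \<Rightarrow> real^'n^'n" and R :: "nat \<Rightarrow> real^'m^'m" and Q :: "nat \<Rightarrow> real^'r^'r"
      and S :: "nat \<times> nat \<times> nat \<times> nat \<Rightarrow> ('n, 'm, 'r) params"
      and \<Pi>s :: "nat \<times> nat \<times> nat \<times> nat \<Rightarrow> real \<Rightarrow> real^'n^'n"
      and xh :: "nat \<times> nat \<times> nat \<times> nat \<Rightarrow> real \<Rightarrow> real^'n"
      and V xinf and xth :: "real \<Rightarrow> real \<Rightarrow> real^'n" and \<sigma>bar
    assume fin: "finite \<Sigma>A" "finite \<Sigma>G" "finite \<Sigma>R" "finite \<Sigma>Q"
      and ne: "\<Sigma>A \<noteq> {}" "\<Sigma>G \<noteq> {}" "\<Sigma>R \<noteq> {}" "\<Sigma>Q \<noteq> {}"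
      and \<Sigma>: "\<Sigma> = \<Sigma>A \<times> \<Sigma>G \<times> \<Sigma>R \<times> \<Sigma>Q"
      and K: "\<forall>\<sigma>\<in>\<Sigma>. S \<sigma> \<in> K"
      and X: "\<forall>\<sigma>\<in>\<Sigma>. riccati_solution T B C (S \<sigma>) (\<Pi>s \<sigma>)"
      and xh: "\<forall>\<sigma>\<in>\<Sigma>. observer_solution T C x0 y (S \<sigma>) (\<Pi>s \<sigma>) (xh \<sigma>)"
      and V: "V = (\<lambda>\<sigma>. value_fun C y (S \<sigma>) (\<Pi>s \<sigma>) (xh \<sigma>))"
      and minf: "\<forall>t\<in>{0..T}. is_arg_min (max_cost \<Sigma> V t) (\<lambda>_. True) (xinf t)"
      and mexp: "\<forall>\<theta>>0. \<forall>t\<in>{0..T}. is_arg_min (exp_cost \<theta> \<Sigma> V t) (\<lambda>_. True) (xth \<theta> t)"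
      and \<sigma>bar: "\<sigma>bar \<in> \<Sigma>"
    let ?\<delta> = "\<lambda>\<sigma>. params_norm \<nu>n \<nu>m \<nu>r (S \<sigma> - S \<sigma>bar)"
    have ua: "uniformly_admissible \<epsilon> \<rho> (S \<sigma>)" if "\<sigma> \<in> \<Sigma>" for \<sigma>
      using adm K that by blast
    have costs: "quadratic_costs \<Sigma> (\<lambda>\<sigma>. matrix_inv (\<Pi>s \<sigma> t)) (\<lambda>\<sigma>. xh \<sigma> t)
        (\<lambda>\<sigma>. LINT s:{0..t}|lebesgue.
           wnorm_sq (matrix_inv (snd (snd (snd (S \<sigma>))))) (y s - C *v xh \<sigma> s))
        (\<alpha> / \<beta>\<^sup>2) (1 / \<alpha>) V t" if t: "t \<in> {0..T}" for t
    proof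
      show "finite \<Sigma>" "\<Sigma> \<noteq> {}" using fin ne by (auto simp: \<Sigma>)
      show "0 < \<alpha> / \<beta>\<^sup>2" "0 \<le> 1 / \<alpha>" using \<alpha> \<beta> by auto
      fix \<sigma> assume \<sigma>: "\<sigma> \<in> \<Sigma>"
      have co: "coercive \<alpha> (\<Pi>s \<sigma> t)" and bd: "norm (\<Pi>s \<sigma> t *v x) \<le> \<beta> * norm x" for x
        using ric[OF ua[OF \<sigma>] _ t] X \<sigma> by auto
      show "coercive (\<alpha> / \<beta>\<^sup>2) (matrix_inv (\<Pi>s \<sigma> t))"
        by (rule coercive_matrix_inv_of_norm_le[OF co \<alpha> bd \<beta>])
      show "norm (matrix_inv (\<Pi>s \<sigma> t) *v x) \<le> 1 / \<alpha> * norm x" for x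
        by (rule norm_matrix_inv_vector_le[OF co \<alpha>])
      show "V \<sigma> t x = wnorm_sq (matrix_inv (\<Pi>s \<sigma> t)) (x - xh \<sigma> t) + (LINT s:{0..t}|lebesgue.
           wnorm_sq (matrix_inv (snd (snd (snd (S \<sigma>))))) (y s - C *v xh \<sigma> s))" for x
        by (cases "S \<sigma>" rule: prod_cases4) (simp add: V)
    qed
    have \<delta>: "norm (xh \<sigma> t - xh \<sigma>bar t) \<le> (l * k + 1) * ?\<delta> \<sigma>" if t: "t \<in> {0..T}" and \<sigma>: "\<sigma> \<in> \<Sigma>" for t \<sigma>
    proof -
      have "norm (xh \<sigma> t - xh \<sigma>bar t) \<le> l * dist (S \<sigma>) (S \<sigma>bar)"
        using obs[OF ua[OF \<sigma>] _ _ ua[OF \<sigma>bar] _ _ t] X xh \<sigma> \<sigma>bar by blast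
      also have "\<dots> \<le> l * (k * ?\<delta> \<sigma>)"
        unfolding dist_norm by (intro mult_left_mono k(2) l)
      also have "\<dots> \<le> (l * k + 1) * ?\<delta> \<sigma>"
        using nonneg[of "S \<sigma> - S \<sigma>bar"] by (simp add: algebra_simps)
      finally show ?thesis .
    qed
    have L: "0 \<le> l * k + 1" using l k(1) by simp
    note bounds = quadratic_costs.minimiser_weighted_norm_bounds[OF costs \<sigma>bar \<delta> L,
        folded c_def]
    show "(\<forall>t\<in>{0..T}.
         wnorm (matrix_inv (\<Pi>s \<sigma>bar t)) (xinf t - xh \<sigma>bar t)
           \<le> c * (MAX \<sigma>\<in>\<Sigma>. params_norm \<nu>n \<nu>m \<nu>r (S \<sigma> - S \<sigma>bar))) \<and>
      (\<forall>\<theta>>0. \<forall>t\<in>{0..T}.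
         wnorm (matrix_inv (\<Pi>s \<sigma>bar t)) (xth \<theta> t - xh \<sigma>bar t)
           \<le> c * (MAX \<sigma>\<in>\<Sigma>. params_norm \<nu>n \<nu>m \<nu>r (S \<sigma> - S \<sigma>bar))) \<and>
      (\<forall>\<theta>>0. \<forall>t\<in>{0..T}.
         wnorm (matrix_inv (\<Pi>s \<sigma>bar t)) (xth \<theta> t - xh \<sigma>bar t)
           \<le> c * exp (\<theta> * value_gap \<Sigma> V t (xth \<theta> t))
               * uniform_mean \<Sigma> (\<lambda>\<sigma>. params_norm \<nu>n \<nu>m \<nu>r (S \<sigma> - S \<sigma>bar)))"
      using bounds minf mexp by (simp add: mult.assoc)
  qed
qed

end
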